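(* Let $G$ be a topological group acting on $\mathcal{X}^n$, let $\{\mathbf{P}_g\}_{g\in G}$ and $\{\mathbf{Q}_g\}_{g\in G}$ be two families of probability distributions on $\mathcal{X}^n$, and let $M_n=m_n(X^n)$ be any maximally invariant statistic under the action of $G$ on $\mathcal{X}^n$. Assume that $G$ is amenable, that the following three properties hold: (1) as topological spaces, $G$ and $\mathcal{X}^n$ are Polish and locally compact (separable, completely metrizable and locally compact), equipped with their Borel $\sigma$-algebras; (2) the action of $G$ on $\mathcal{X}^n$ is free, continuous and proper; (3) the models $\{\mathbf{P}_g\}_{g\in G}$ and $\{\mathbf{Q}_g\}_{g\in G}$ are invariant and have densities $p_g,q_g$ with respect to a common measure $\mu$ on $\mathcal{X}^n$ that is relatively left invariant with some multiplier $\chi$, and all densities have a single common support; and that there is $\varepsilon>0$ such that $$\mathbf{E}^{\mathbf{Q}}_1\left[\left|\ln\frac{q_1(X^n)}{p_1(X^n)}\right|^{1+\varepsilon}\right]<\infty\quad\text{and}\quad \mathbf{E}^{\mathbf{Q}^{M_n}}\left[\left|\ln\frac{q^{M_n}(M_n)}{p^{M_n}(M_n)}\right|^{1+\varepsilon}\right]<\infty,$$ where the subindex $1$ refers to the unit element of $G$. Then the likelihood ratio $$T^{M_n}=\frac{q^{M_n}(m_n(X^n))}{p^{M_n}(m_n(X^n))}$$ is not only GROW, it is also relatively GROW, for testing $\mathcal{H}_0: X^n\sim\mathbf{P}_g,\ g\in G$ against $\mathcal{H}_1: X^n\sim\mathbf{Q}_g,\ g\in G$.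
   Context: $G$ acts on the observation space $\mathcal{X}$ and on $\mathcal{X}^n$ componentwise, $g(x_1,\dots,x_n)=(gx_1,\dots,gx_n)$. $X^n=(X_1,\dots,X_n)$ is the data, with values in $\mathcal{X}^n$; $\mathbf{E}^{\mathbf{P}}_g,\mathbf{E}^{\mathbf{Q}}_g$ are the expectations when $X^n$ has distribution $\mathbf{P}_g$, $\mathbf{Q}_g$. Statistics are measurable functions of the data, with values in any set equipped with a $\sigma$-algebra. Invariance: $\{\mathbf{P}_g\}_{g\in G}$ is invariant if $\mathbf{P}_{hg}\{X^n\in hB\}=\mathbf{P}_g\{X^n\in B\}$ for all $g,h\in G$ and measurable $B\subseteq\mathcal{X}^n$; similarly for $\{\mathbf{Q}_g\}$. Relatively left invariant with multiplier $\chi$: $\mu\{gB\}=\chi(g)\mu\{B\}$ for any measurable $B\subseteq\mathcal{X}^n$ and $g\in G$. Single common support: the densities $p_g,q_g$ are positive on one and the same set. Free action: $gx=x$ for some $x$ implies $g$ is the identity. Proper action: the map $(g,x)\mapsto(gx,x)$ from $G\times\mathcal{X}^n$ to $\mathcal{X}^n\times\mathcal{X}^n$ has compact preimages of compact sets. Maximally invariant: $m_n(x)=m_n(x')$ if and only if there is $g\in G$ with $x=gx'$. By invariance of the models, the distribution of $M_n$ under $\mathbf{P}_g$ (resp. $\mathbf{Q}_g$) does not depend on $g$; it is denoted $\mathbf{P}^{M_n}$ (resp. $\mathbf{Q}^{M_n}$), with density $p^{M_n}$ (resp. $q^{M_n}$) with respect to a common dominating measure. Amenability: $G$ is amenable if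 there is a sequence $\mathbf{\Pi}_1,\mathbf{\Pi}_2,\dots$ of probability distributions on $G$ such that $\lim_{k\to\infty}|\mathbf{\Pi}_k\{B\}-\mathbf{\Pi}_k\{Bg\}|=0$ for every measurable $B\subseteq G$ and every $g\in G$. E-statistic: a real-valued statistic $T_n=t_n(X^n)\ge 0$ with $\sup_{g\in G}\mathbf{E}^{\mathbf{P}}_g[T_n]\le 1$. GROW: maximizes $T_n\mapsto\inf_{g\in G}\mathbf{E}^{\mathbf{Q}}_g[\ln T_n]$ over all e-statistics. Relatively GROW: maximizes $T_n\mapsto\inf_{g\in G}\{\mathbf{E}^{\mathbf{Q}}_g[\ln T_n]-\sup_{T_n'\ \text{e-statistic}}\mathbf{E}^{\mathbf{Q}}_g[\ln T_n']\}$ over all e-statistics.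
   Formalization: The σ-algebra on the value space of the maximally invariant statistic is additionally assumed to contain countably many sets separating the values taken by m_n; for a too coarse (e.g. trivial) σ-algebra the claim as stated is false. *)

theory Defs
  imports "HOL-Probability.Probability"
begin

section \<open>Group actions\<close>

text \<open>
  The group is written additively, since \<^class>\<open>topological_group_add\<close> is the library's class of
  topological groups; commutativity is not part of \<^class>\<open>group_add\<close>. Thus \<open>g + h\<close> is the product
  \<open>gh\<close> and \<open>0\<close> is the unit element.
\<close>

definition is_action :: "('g::group_add \<Rightarrow> 'a \<Rightarrow> 'a) \<Rightarrow> bool" where
  "is_action act \<longleftrightarrow> (\<forall>x. act 0 x = x) \<and> (\<forall>g h x. act (g + h) x = act g (act h x))"

definition free_action :: "('g::group_add \<Rightarrow> 'a \<Rightarrow> 'a) \<Rightarrow> bool" where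
  "free_action act \<longleftrightarrow> (\<forall>g. (\<exists>x. act g x = x) \<longrightarrow> g = 0)"

definition continuous_action ::
  "('g::{group_add, topological_space} \<Rightarrow> 'a::topological_space \<Rightarrow> 'a) \<Rightarrow> bool" where
  "continuous_action act \<longleftrightarrow> continuous_on UNIV (\<lambda>(g, x). act g x)"

definition proper_action ::
  "('g::{group_add, topological_space} \<Rightarrow> 'a::topological_space \<Rightarrow> 'a) \<Rightarrow> bool" where
  "proper_action act \<longleftrightarrow> (\<forall>K. compact K \<longrightarrow> compact ((\<lambda>(g, x). (act g x, x)) -` K))"

text \<open>
  Samples \<open>(x\<^sub>1, \<dots>, x\<^sub>n)\<close> are functions from a finite index type, which carry the product topology.
\<close>

definition componentwise :: "('g \<Rightarrow> 'x \<Rightarrow> 'x) \<Rightarrow> 'g \<Rightarrow> ('n \<Rightarrow> 'x) \<Rightarrow> ('n \<Rightarrow> 'x)" where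
  "componentwise act g x = (\<lambda>i. act g (x i))"

definition maximally_invariant :: "('g \<Rightarrow> 'a \<Rightarrow> 'a) \<Rightarrow> ('a \<Rightarrow> 'm) \<Rightarrow> bool" where
  "maximally_invariant act m \<longleftrightarrow> (\<forall>x x'. m x = m x' \<longleftrightarrow> (\<exists>g. x = act g x'))"

definition amenable :: "'g::{group_add, topological_space} itself \<Rightarrow> bool" where
  "amenable _ \<longleftrightarrow>
     (\<exists>\<Psi> :: nat \<Rightarrow> 'g measure.
        (\<forall>k. prob_space (\<Psi> k) \<and> sets (\<Psi> k) = sets borel) \<and>
        (\<forall>B\<in>sets borel. \<forall>g.
           (\<lambda>k. \<bar>measure (\<Psi> k) B - measure (\<Psi> k) ((\<lambda>h. h + g) ` B)\<bar>) \<longlonglongrightarrow> 0))"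


section \<open>Models and measures\<close>

definition invariant_model ::
  "('g::group_add \<Rightarrow> 'a::topological_space \<Rightarrow> 'a) \<Rightarrow> ('g \<Rightarrow> 'a measure) \<Rightarrow> bool" where
  "invariant_model act P \<longleftrightarrow>
     (\<forall>g h. \<forall>B\<in>sets borel. measure (P (h + g)) (act h ` B) = measure (P g) B)"

definition relatively_left_invariant ::
  "('g \<Rightarrow> 'a::topological_space \<Rightarrow> 'a) \<Rightarrow> ('g \<Rightarrow> real) \<Rightarrow> 'a measure \<Rightarrow> bool" where
  "relatively_left_invariant act \<kappa> \<mu> \<longleftrightarrow>
     (\<forall>g. 0 < \<kappa> g) \<and>
     (\<forall>g. \<forall>B\<in>sets borel. emeasure \<mu> (act g ` B) = ennreal (\<kappa> g) * emeasure \<mu> B)"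

definition single_common_support ::
  "('g \<Rightarrow> 'a \<Rightarrow> real) \<Rightarrow> ('g \<Rightarrow> 'a \<Rightarrow> real) \<Rightarrow> bool" where
  "single_common_support p q \<longleftrightarrow> (\<exists>S. \<forall>g. {x. 0 < p g x} = S \<and> {x. 0 < q g x} = S)"

definition countably_separated :: "'m measure \<Rightarrow> bool" where
  "countably_separated N \<longleftrightarrow>
     (\<exists>\<A>. countable \<A> \<and> \<A> \<subseteq> sets N \<and>
        (\<forall>y\<in>space N. \<forall>y'\<in>space N. (\<forall>A\<in>\<A>. y \<in> A \<longleftrightarrow> y' \<in> A) \<longrightarrow> y = y'))"


section \<open>E-statistics and growth optimality\<close>

definition ereal_ln :: "real \<Rightarrow> ereal" where
  "ereal_ln t = (if 0 < t then ereal (ln t) else - \<infinity>)"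

text \<open>
  Since \<^const>\<open>e2ennreal\<close> maps negative numbers to \<open>0\<close>, the two integrals are those of the positive
  and of the negative part. The value where both are infinite is the library's \<open>\<infinity> - \<infinity> = \<infinity>\<close>. This
  convention is immaterial for \<open>\<integral> ln T dQ\<close> if \<open>T\<close> is an e-statistic for \<open>P\<close> and \<open>Q\<close> has finite relative
  entropy with respect to \<open>P\<close>: the positive part of \<open>ln T\<close> is then \<open>Q\<close>-integrable.
\<close>

definition ereal_expectation :: "'a measure \<Rightarrow> ('a \<Rightarrow> ereal) \<Rightarrow> ereal" where
  "ereal_expectation M f =
     enn2ereal (\<integral>\<^sup>+x. e2ennreal (f x) \<partial>M) - enn2ereal (\<integral>\<^sup>+x. e2ennreal (- f x) \<partial>M)"

abbreviation expected_log :: "'a measure \<Rightarrow> ('a \<Rightarrow> real) \<Rightarrow> ereal" where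
  "expected_log M T \<equiv> ereal_expectation M (\<lambda>x. ereal_ln (T x))"

definition e_statistic ::
  "('g \<Rightarrow> 'a::topological_space measure) \<Rightarrow> ('a \<Rightarrow> real) \<Rightarrow> bool" where
  "e_statistic P T \<longleftrightarrow>
     T \<in> borel_measurable borel \<and> (\<forall>x. 0 \<le> T x) \<and> (SUP g. \<integral>\<^sup>+x. ennreal (T x) \<partial>P g) \<le> 1"

definition GROW ::
  "('g \<Rightarrow> 'a::topological_space measure) \<Rightarrow> ('g \<Rightarrow> 'a measure) \<Rightarrow> ('a \<Rightarrow> real) \<Rightarrow> bool" where
  "GROW P Q T \<longleftrightarrow> e_statistic P T \<and>
     (\<forall>T'. e_statistic P T' \<longrightarrow> (INF g. expected_log (Q g) T') \<le> (INF g. expected_log (Q g) T))"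

definition relative_growth ::
  "('g \<Rightarrow> 'a::topological_space measure) \<Rightarrow> ('g \<Rightarrow> 'a measure) \<Rightarrow> ('a \<Rightarrow> real) \<Rightarrow> ereal" where
  "relative_growth P Q T =
     (INF g. expected_log (Q g) T - (SUP T'\<in>{T'. e_statistic P T'}. expected_log (Q g) T'))"

definition relatively_GROW ::
  "('g \<Rightarrow> 'a::topological_space measure) \<Rightarrow> ('g \<Rightarrow> 'a measure) \<Rightarrow> ('a \<Rightarrow> real) \<Rightarrow> bool" where
  "relatively_GROW P Q T \<longleftrightarrow> e_statistic P T \<and>
     (\<forall>T'. e_statistic P T' \<longrightarrow> relative_growth P Q T' \<le> relative_growth P Q T)"

end

theory Submission
  imports Defs
begin

text \<open>
  Write \<open>T\<close> for the likelihood ratio of the maximal invariant and \<open>K\<close> for the expectation of \<open>ln T\<close> under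
  \<open>Q 0\<close>. As \<open>T\<close> is invariant, it has expectation at most \<open>1\<close> under every \<open>P g\<close>, and \<open>ln T\<close> has
  expectation \<open>K\<close> under every \<open>Q g\<close>. Hence \<open>T\<close> is GROW as soon as every e-statistic \<open>T'\<close> satisfies
  \<open>INF g. E\<^bsub>Q g\<^esub> ln T' \<le> K\<close> (\<open>worst_case_growth_le\<close>).

  Let first \<open>\<phi> = ln T'\<close> be bounded, with \<open>v \<le> E\<^bsub>Q g\<^esub> \<phi>\<close> for all \<open>g\<close>. Average \<open>\<phi>\<close> over orbits with the
  asymptotically invariant distributions \<open>\<Psi> k\<close> on the group: \<open>L\<^sub>k x = \<integral> \<phi> (g x) d\<Psi>\<^sub>k\<close>. By invariance of
  the models and Jensen's inequality, \<open>v \<le> E\<^bsub>Q 0\<^esub> L\<^sub>k\<close> and \<open>E\<^bsub>P 0\<^esub> (exp L\<^sub>k) \<le> 1\<close>, and amenability makes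
  \<open>L\<^sub>k (h x) - L\<^sub>k x\<close> tend to \<open>0\<close> at every point \<open>x\<close>. All three properties pass to convex combinations of
  the tails of the sequence, and some of these converge almost everywhere, because a minimising
  sequence for the norm of \<open>L\<^sup>2\<close> is Cauchy (\<open>midpoint_closed_AE_convergent\<close>). The limit \<open>f\<close> is exactly
  invariant, with \<open>v \<le> E\<^bsub>Q 0\<^esub> f\<close> and \<open>E\<^bsub>P 0\<^esub> (exp f) \<le> 1\<close> (\<open>orbit_averages_limit\<close>). An invariant \<open>f\<close> is
  almost everywhere a function of the maximal invariant, and for such functions the measure with
  density \<open>1 / T\<close> with respect to \<open>Q 0\<close> is at most \<open>P 0\<close>; so \<open>ln y \<le> y - 1\<close> yields
  \<open>E\<^bsub>Q 0\<^esub> (f - ln T) \<le> E\<^bsub>Q 0\<^esub> (exp f / T) - 1 \<le> E\<^bsub>P 0\<^esub> (exp f) - 1 \<le> 0\<close>, hence \<open>v \<le> K\<close>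
  (\<open>invariant_log_expectation_le\<close>).

  That invariant Borel sets are almost everywhere preimages under the maximal invariant is where
  countable separation enters: countably many sets \<open>B\<^sub>i\<close> separate the orbits, inner regularity gives large
  compact sets in which all \<open>B\<^sub>i\<close> are relatively clopen, and the union of the orbits that meet such a compact
  set lies in the \<open>\<sigma>\<close>-algebra generated by the \<open>B\<^sub>i\<close> (\<open>saturated_AE_in_sigma_sets\<close>).

  An arbitrary e-statistic is replaced by \<open>min (exp (2 * c)) ((1 - \<delta>) * T' + \<delta>)\<close>. The loss is small
  uniformly in \<open>g\<close>, since it is controlled by the tail of the \<open>Q 0\<close>-integrable function \<open>ln (q 0 / p 0)\<close>
  (\<open>expected_log_le_truncated\<close>).

  Finally, translation by a group element maps e-statistics to e-statistics, so that the oracle growth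
  rate \<open>SUP T'. E\<^bsub>Q g\<^esub> ln T'\<close> is one finite number for all \<open>g\<close>. Subtracting it does not change
  which e-statistics are optimal, so that \<open>T\<close> is relatively GROW as well.
\<close>

section \<open>Expected logarithms\<close>

lemma ereal_expectation_mono_AE:
  assumes "AE x in M. f x \<le> g x"
  shows "ereal_expectation M f \<le> ereal_expectation M g"
  unfolding ereal_expectation_def
proof (rule ereal_minus_mono)
  show "enn2ereal (\<integral>\<^sup>+x. e2ennreal (f x) \<partial>M) \<le> enn2ereal (\<integral>\<^sup>+x. e2ennreal (g x) \<partial>M)"
    unfolding less_eq_ennreal.rep_eq[symmetric]
    by (rule nn_integral_mono_AE) (use assms in \<open>eventually_elim, auto intro: e2ennreal_mono\<close>)
  show "enn2ereal (\<integral>\<^sup>+x. e2ennreal (- g x) \<partial>M) \<le> enn2ereal (\<integral>\<^sup>+x. e2ennreal (- f x) \<partial>M)"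
    unfolding less_eq_ennreal.rep_eq[symmetric]
    by (rule nn_integral_mono_AE) (use assms in \<open>eventually_elim, auto intro: e2ennreal_mono\<close>)
qed

lemma ereal_expectation_integrable:
  assumes "integrable M g"
  shows "ereal_expectation M (\<lambda>x. ereal (g x)) = ereal (\<integral>x. g x \<partial>M)"
proof -
  have "(\<integral>\<^sup>+x. ennreal (g x) \<partial>M) \<noteq> \<infinity>" "(\<integral>\<^sup>+x. ennreal (- g x) \<partial>M) \<noteq> \<infinity>"
    using assms by (auto simp: real_integrable_def)
  then show ?thesis
    unfolding ereal_expectation_def real_lebesgue_integral_def[OF assms]
    by (cases rule: ennreal2_cases[of "\<integral>\<^sup>+x. ennreal (g x) \<partial>M" "\<integral>\<^sup>+x. ennreal (- g x) \<partial>M"])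
       (auto simp: enn2ereal_ennreal)
qed

lemma measurable_ereal_ln[measurable]: "ereal_ln \<in> borel_measurable borel"
  unfolding ereal_ln_def[abs_def] by measurable

lemma expected_log_distr:
  assumes [measurable]: "f \<in> M \<rightarrow>\<^sub>M N" "T \<in> borel_measurable N"
  shows "expected_log (distr M N f) T = expected_log M (\<lambda>x. T (f x))"
  unfolding ereal_expectation_def by (simp add: nn_integral_distr)

lemma expected_log_real:
  assumes "AE x in M. 0 < T x" "integrable M (\<lambda>x. ln (T x))"
  shows "expected_log M T = ereal (\<integral>x. ln (T x) \<partial>M)"
proof -
  have "AE x in M. ereal_ln (T x) = ereal (ln (T x))"
    using assms(1) by (auto simp: ereal_ln_def)
  then have "expected_log M T = ereal_expectation M (\<lambda>x. ereal (ln (T x)))"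
    by (intro antisym ereal_expectation_mono_AE) auto
  then show ?thesis
    using ereal_expectation_integrable[OF assms(2)] by simp
qed

text \<open>
  With \<open>y = exp (- c) * v / r\<close> one has \<open>ln v = ln y + c + ln r\<close> and \<open>ln y \<le> y\<close>: the part of \<open>ln v\<close> above
  \<open>2 * c\<close> is at most \<open>y\<close> plus the part of \<open>ln r\<close> above \<open>c\<close>. The constant \<open>\<delta>\<close> makes \<open>v\<close> bounded away
  from \<open>0\<close> at the cost of the term \<open>ln (1 - \<delta>)\<close>.
\<close>

lemma ereal_ln_le_truncated:
  fixes u \<delta> c r :: real
  assumes "0 \<le> u" "0 < \<delta>" "\<delta> < 1" "0 < r"
  defines "v \<equiv> (1 - \<delta>) * u + \<delta>"
  shows "ereal_ln u \<le> ereal (ln (min (exp (2 * c)) v) + exp (- c) * (v / r)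
           + max 0 (ln r - c) - ln (1 - \<delta>))"
proof (cases "u = 0")
  case False
  then have "0 < u" "0 < (1 - \<delta>) * u" using assms by auto
  then have v: "0 < v" "(1 - \<delta>) * u \<le> v"
    using \<open>0 < \<delta>\<close> unfolding v_def by linarith+
  have "ln ((1 - \<delta>) * u) \<le> ln v" using v \<open>0 < (1 - \<delta>) * u\<close> by simp
  then have 1: "ln u \<le> ln v - ln (1 - \<delta>)"
    using \<open>0 < u\<close> assms by (simp add: ln_mult)
  define y where "y = exp (- c) * (v / r)"
  have "0 < y" using v assms by (simp add: y_def)
  have "ln v \<le> ln (min (exp (2 * c)) v) + y + max 0 (ln r - c)"
  proof (cases "v \<le> exp (2 * c)")
    case True
    then show ?thesis using \<open>0 < y\<close> by (simp add: min_def)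
  next
    case False
    have "ln y = ln v - ln r - c"
      using v \<open>0 < r\<close> by (simp add: y_def ln_mult ln_div)
    moreover have "ln y \<le> y" using ln_le_minus_one[OF \<open>0 < y\<close>] by simp
    ultimately show ?thesis using False by (auto simp: min_def)
  qed
  with 1 show ?thesis using \<open>0 < u\<close> by (simp add: ereal_ln_def y_def)
qed (simp add: ereal_ln_def)

lemma abs_ln_truncated_le:
  fixes \<delta> c v :: real
  assumes "0 < \<delta>" "\<delta> \<le> v"
  shows "\<bar>ln (min (exp (2 * c)) v)\<bar> \<le> \<bar>2 * c\<bar> + \<bar>ln \<delta>\<bar>"
proof -
  have "ln (min (exp (2 * c)) \<delta>) \<le> ln (min (exp (2 * c)) v)"
    "ln (min (exp (2 * c)) v) \<le> ln (exp (2 * c))"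
    using assms by (subst ln_le_cancel_iff; force simp: min_def)+
  moreover have "\<bar>ln (min (exp (2 * c)) \<delta>)\<bar> \<le> \<bar>2 * c\<bar> + \<bar>ln \<delta>\<bar>"
    by (simp add: min_def)
  ultimately show ?thesis unfolding ln_exp by linarith
qed

lemma (in prob_space) nn_integral_mixture_le:
  fixes U :: "'a \<Rightarrow> real"
  assumes [measurable]: "U \<in> borel_measurable M"
    and U: "\<And>x. 0 \<le> U x" "(\<integral>\<^sup>+x. ennreal (U x) \<partial>M) \<le> 1" and "0 < \<delta>" "\<delta> < 1"
  shows "(\<integral>\<^sup>+x. ennreal ((1 - \<delta>) * U x + \<delta>) \<partial>M) \<le> 1"
proof -
  have "(\<integral>\<^sup>+x. ennreal ((1 - \<delta>) * U x + \<delta>) \<partial>M) = ennreal (1 - \<delta>) * (\<integral>\<^sup>+x. ennreal (U x) \<partial>M) + ennreal \<delta>"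
    using U \<open>0 < \<delta>\<close> \<open>\<delta> < 1\<close>
    by (simp add: ennreal_plus ennreal_mult nn_integral_add nn_integral_cmult emeasure_space_1
        del: ennreal_plus[symmetric])
  also have "\<dots> \<le> ennreal (1 - \<delta>) * 1 + ennreal \<delta>"
    by (intro add_right_mono mult_left_mono U) simp
  also have "\<dots> = 1"
    using \<open>0 < \<delta>\<close> \<open>\<delta> < 1\<close> by (simp flip: ennreal_plus)
  finally show ?thesis .
qed

text \<open>
  The error term does not depend on \<open>U\<close>: if \<open>r\<close> is the density of \<open>Q\<close> with respect to \<open>P\<close>, then
  \<open>V / r\<close>, with \<open>V = (1 - \<delta>) * U + \<delta>\<close>, has \<open>Q\<close>-expectation at most the \<open>P\<close>-expectation of \<open>V\<close>, which
  is at most \<open>1\<close>. This uniformity is what permits truncation inside an infimum over the group.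
\<close>

lemma expected_log_le_truncated:
  fixes r U :: "'a \<Rightarrow> real"
  assumes P: "prob_space P" and Q: "prob_space Q" and QP: "Q = density P (\<lambda>x. ennreal (r x))"
    and [measurable]: "r \<in> borel_measurable P" "U \<in> borel_measurable P"
    and r: "\<And>x. 0 \<le> r x" and ln_r: "integrable Q (\<lambda>x. ln (r x))"
    and U: "\<And>x. 0 \<le> U x" "(\<integral>\<^sup>+x. ennreal (U x) \<partial>P) \<le> 1"
    and "0 < \<delta>" "\<delta> < 1"
  shows "expected_log Q U \<le>
    ereal ((\<integral>x. ln (min (exp (2 * c)) ((1 - \<delta>) * U x + \<delta>)) \<partial>Q)
      + (exp (- c) + (\<integral>x. max 0 (ln (r x) - c) \<partial>Q) - ln (1 - \<delta>)))"
proof -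
  interpret P: prob_space P by fact
  interpret Q: prob_space Q by fact
  have sQ[measurable_cong]: "sets Q = sets P" by (simp add: QP)
  define V where "V = (\<lambda>x. (1 - \<delta>) * U x + \<delta>)"
  have [measurable]: "V \<in> borel_measurable P" by (simp add: V_def)
  have V: "\<delta> \<le> V x" for x using U \<open>\<delta> < 1\<close> by (simp add: V_def)
  have r_pos: "AE x in Q. 0 < r x"
    unfolding QP by (subst AE_density) (auto simp: ennreal_eq_0_iff not_le less_le)
  have "(\<integral>\<^sup>+x. ennreal (V x / r x) \<partial>Q) = (\<integral>\<^sup>+x. ennreal (r x) * ennreal (V x / r x) \<partial>P)"
    unfolding QP by (rule nn_integral_density) auto
  also have "\<dots> \<le> (\<integral>\<^sup>+x. ennreal (V x) \<partial>P)"
  proof (rule nn_integral_mono)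
    fix x
    have "r x * (V x / r x) \<le> V x" using V[of x] \<open>0 < \<delta>\<close> by (cases "r x = 0") auto
    then show "ennreal (r x) * ennreal (V x / r x) \<le> ennreal (V x)"
      by (simp add: ennreal_mult'[OF r, symmetric] ennreal_leI)
  qed
  also have "\<dots> \<le> 1"
    unfolding V_def by (rule P.nn_integral_mixture_le) (use U \<open>0 < \<delta>\<close> \<open>\<delta> < 1\<close> in auto)
  finally have V1: "(\<integral>\<^sup>+x. ennreal (V x / r x) \<partial>Q) \<le> 1" .
  have Vr0: "0 \<le> V x / r x" for x using V[of x] \<open>0 < \<delta>\<close> r[of x] by simp
  have Vr: "integrable Q (\<lambda>x. V x / r x)"
    by (rule integrableI_nonneg)
       (use order.strict_trans1[OF V1 ennreal_one_less_top] Vr0 in auto)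
  have "ennreal (\<integral>x. V x / r x \<partial>Q) \<le> 1"
    using V1 nn_integral_eq_integral[OF Vr] Vr0 by simp
  then have EV: "(\<integral>x. V x / r x \<partial>Q) \<le> 1" by (simp)
  have lnr': "integrable Q (\<lambda>x. max 0 (ln (r x) - c))"
    using ln_r by (intro integrable_max) auto
  have B: "integrable Q (\<lambda>x. ln (min (exp (2 * c)) (V x)))"
    using abs_ln_truncated_le[OF \<open>0 < \<delta>\<close> V, of c]
    by (intro Q.integrable_const_bound[of _ "\<bar>2 * c\<bar> + \<bar>ln \<delta>\<bar>"]) auto
  have "expected_log Q U \<le> ereal_expectation Q (\<lambda>x. ereal (ln (min (exp (2 * c)) (V x))
          + exp (- c) * (V x / r x) + max 0 (ln (r x) - c) - ln (1 - \<delta>)))"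
    using r_pos ereal_ln_le_truncated[OF U(1) \<open>0 < \<delta>\<close> \<open>\<delta> < 1\<close>]
    by (intro ereal_expectation_mono_AE) (auto simp: V_def)
  also have "\<dots> = ereal (\<integral>x. (ln (min (exp (2 * c)) (V x))
          + exp (- c) * (V x / r x) + max 0 (ln (r x) - c) - ln (1 - \<delta>)) \<partial>Q)"
    by (intro ereal_expectation_integrable Bochner_Integration.integrable_add
        Bochner_Integration.integrable_diff integrable_mult_right B Vr lnr') simp
  also have "(\<integral>x. (ln (min (exp (2 * c)) (V x))
          + exp (- c) * (V x / r x) + max 0 (ln (r x) - c) - ln (1 - \<delta>)) \<partial>Q)
     = (\<integral>x. ln (min (exp (2 * c)) (V x)) \<partial>Q) + exp (- c) * (\<integral>x. V x / r x \<partial>Q)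
       + (\<integral>x. max 0 (ln (r x) - c) \<partial>Q) - ln (1 - \<delta>)"
    using B Vr lnr' by (simp add: Q.prob_space del: times_divide_eq_right)
  also have "\<dots> \<le> (\<integral>x. ln (min (exp (2 * c)) (V x)) \<partial>Q)
      + (exp (- c) + (\<integral>x. max 0 (ln (r x) - c) \<partial>Q) - ln (1 - \<delta>))"
    using EV by simp
  finally show ?thesis by (simp add: V_def)
qed

lemma truncation_error_vanishes:
  fixes r :: "'a \<Rightarrow> real"
  assumes "integrable Q (\<lambda>x. ln (r x))" and "0 < \<eta>"
  obtains c \<delta> where "0 < \<delta>" "\<delta> < 1"
    "exp (- c) + (\<integral>x. max 0 (ln (r x) - c) \<partial>Q) - ln (1 - \<delta>) < \<eta>"
proof -
  have [measurable]: "(\<lambda>x. ln (r x)) \<in> borel_measurable Q" using assms(1) by auto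
  have "(\<lambda>n. \<integral>x. max 0 (ln (r x) - real n) \<partial>Q) \<longlonglongrightarrow> (\<integral>x. 0 \<partial>Q)"
  proof (rule integral_dominated_convergence)
    show "AE x in Q. (\<lambda>n. max 0 (ln (r x) - real n)) \<longlonglongrightarrow> 0"
    proof (rule AE_I2)
      fix x
      have "eventually (\<lambda>n. max 0 (ln (r x) - real n) = 0) sequentially"
        using eventually_ge_at_top[of "nat \<lceil>ln (r x)\<rceil>"]
        by eventually_elim (simp add: nat_le_iff ceiling_le_iff)
      then show "(\<lambda>n. max 0 (ln (r x) - real n)) \<longlonglongrightarrow> 0"
        by (rule tendsto_eventually)
    qed
    show "integrable Q (\<lambda>x. \<bar>ln (r x)\<bar>)" using assms(1) by simp
  qed (auto intro!: AE_I2)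
  moreover have "(\<lambda>n. exp (- real n)) \<longlonglongrightarrow> 0"
    by (rule filterlim_compose[OF exp_at_bot])
       (simp add: filterlim_uminus_at_bot filterlim_real_sequentially)
  ultimately have "(\<lambda>n. exp (- real n) + (\<integral>x. max 0 (ln (r x) - real n) \<partial>Q)
      + inverse (real (Suc n))) \<longlonglongrightarrow> 0 + (\<integral>x. 0 \<partial>Q) + 0"
    by (intro tendsto_intros LIMSEQ_inverse_real_of_nat)
  then have "eventually (\<lambda>n. exp (- real n) + (\<integral>x. max 0 (ln (r x) - real n) \<partial>Q)
      + inverse (real (Suc n)) < \<eta>) sequentially"
    using \<open>0 < \<eta>\<close> by (intro order_tendstoD(2)) auto
  then obtain n where "exp (- real n) + (\<integral>x. max 0 (ln (r x) - real n) \<partial>Q)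
      + inverse (real (Suc n)) < \<eta>"
    using eventually_happens'[OF sequentially_bot] by blast
  \<comment> \<open>This \<open>\<delta>\<close> is chosen so that \<open>- ln (1 - \<delta>) = 1 / (n + 1)\<close>.\<close>
  then show thesis by (intro that[of "1 - exp (- inverse (real (Suc n)))" "real n"]) auto
qed

lemma (in prob_space) integrable_of_moment:
  fixes g :: "'a \<Rightarrow> real"
  assumes [measurable]: "g \<in> borel_measurable M"
    and "0 < \<epsilon>" and moment: "(\<integral>\<^sup>+x. ennreal (\<bar>g x\<bar> powr (1 + \<epsilon>)) \<partial>M) < \<infinity>"
  shows "integrable M g"
proof (rule Bochner_Integration.integrable_bound)
  have "integrable M (\<lambda>x. \<bar>g x\<bar> powr (1 + \<epsilon>))"
    by (rule integrableI_nonneg) (use moment in auto)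
  then show "integrable M (\<lambda>x. 1 + \<bar>g x\<bar> powr (1 + \<epsilon>))" by simp
  show "AE x in M. norm (g x) \<le> norm (1 + \<bar>g x\<bar> powr (1 + \<epsilon>))"
  proof (rule AE_I2)
    fix x
    have "\<bar>g x\<bar> \<le> 1 + \<bar>g x\<bar> powr (1 + \<epsilon>)"
    proof (cases "\<bar>g x\<bar> \<le> 1")
      case False
      then have "\<bar>g x\<bar> powr 1 \<le> \<bar>g x\<bar> powr (1 + \<epsilon>)"
        using \<open>0 < \<epsilon>\<close> by (intro powr_mono) auto
      then show ?thesis using False by simp
    qed (use powr_ge_zero[of "\<bar>g x\<bar>" "1 + \<epsilon>"] in linarith)
    then show "norm (g x) \<le> norm (1 + \<bar>g x\<bar> powr (1 + \<epsilon>))"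
      using powr_ge_zero[of "\<bar>g x\<bar>" "1 + \<epsilon>"] by (simp add: add_nonneg_nonneg)
  qed
qed simp

section \<open>Borel sets saturated for countably many Borel sets\<close>

text \<open>
  A point lies in the saturation of \<open>K\<close> if and only if, for every \<open>n\<close>, some point of \<open>K\<close> has the same
  membership pattern in \<open>B 0, \<dots>, B (n - 1)\<close>: the points of \<open>K\<close> with that pattern form a decreasing sequence
  of nonempty compact sets, hence have a common point. For fixed \<open>n\<close> there are only finitely many patterns,
  so that the saturation is a countable intersection of sets in the algebra generated by \<open>B\<close>.
\<close>

lemma compact_saturation_in_sigma_sets:
  fixes K :: "'a::t2_space set" and B :: "nat \<Rightarrow> 'a set"
  assumes K: "compact K" and KB: "\<And>i. compact (K \<inter> B i)" "\<And>i. compact (K - B i)"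
  shows "{x. \<exists>y\<in>K. \<forall>i. x \<in> B i \<longleftrightarrow> y \<in> B i} \<in> sigma_sets UNIV (range B)"
proof -
  define S where "S = sigma UNIV (range B)"
  have [simp]: "space S = UNIV" by (simp add: S_def)
  have [measurable]: "B i \<in> sets S" for i by (auto simp: S_def)
  define E where "E n = {x\<in>space S. \<exists>I\<in>Pow {..<n}. (\<exists>y\<in>K. \<forall>i<n. i \<in> I \<longleftrightarrow> y \<in> B i) \<and>
      (\<forall>i<n. x \<in> B i \<longleftrightarrow> i \<in> I)}" for n :: nat
  have "E n \<in> sets S" for n
    unfolding E_def by measurable
  then have "(\<Inter>n. E n) \<in> sets S" by auto
  also have "(\<Inter>n. E n) = {x. \<exists>y\<in>K. \<forall>i. x \<in> B i \<longleftrightarrow> y \<in> B i}"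
  proof safe
    fix x assume x: "x \<in> (\<Inter>n. E n)"
    define C where "C n = {y\<in>K. \<forall>i<n. x \<in> B i \<longleftrightarrow> y \<in> B i}" for n :: nat
    have C_compact: "compact (C n)" for n
    proof (induction n)
      case (Suc n)
      have "C (Suc n) = C n \<inter> (if x \<in> B n then K \<inter> B n else K - B n)"
        by (auto simp: C_def less_Suc_eq)
      then show ?case using Suc KB by auto
    qed (simp add: C_def K)
    have C_nonempty: "C n \<noteq> {}" for n
    proof -
      have "x \<in> E n" using x by auto
      then obtain I y where "y \<in> K" "\<forall>i<n. i \<in> I \<longleftrightarrow> y \<in> B i" "\<forall>i<n. x \<in> B i \<longleftrightarrow> i \<in> I"
        unfolding E_def by auto
      then have "y \<in> C n" by (simp add: C_def)
      then show ?thesis by auto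
    qed
    have "C 0 \<inter> (\<Inter>n\<in>UNIV. C n) \<noteq> {}"
    proof (rule compact_imp_fip_image[OF C_compact compact_imp_closed[OF C_compact]])
      fix I :: "nat set" assume "finite I"
      then have "C (Max (insert 0 I)) \<subseteq> C n" if "n \<in> insert 0 I" for n
        using Max_ge[OF _ that] by (auto simp: C_def dest: order.strict_trans2)
      then have "C (Max (insert 0 I)) \<subseteq> C 0 \<inter> (\<Inter>n\<in>I. C n)"
        by (intro Int_greatest INT_greatest) simp_all
      then show "C 0 \<inter> (\<Inter>n\<in>I. C n) \<noteq> {}" using C_nonempty[of "Max (insert 0 I)"] by blast
    qed
    then obtain y where "\<And>n. y \<in> C n" by auto
    then have "y \<in> K \<and> (\<forall>i. x \<in> B i \<longleftrightarrow> y \<in> B i)" unfolding C_def by blast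
    then show "\<exists>y\<in>K. \<forall>i. x \<in> B i \<longleftrightarrow> y \<in> B i" by blast
  next
    fix x y n assume y: "y \<in> K" "\<forall>i. x \<in> B i \<longleftrightarrow> y \<in> B i"
    show "x \<in> E n"
      unfolding E_def using y by (auto intro!: bexI[of _ "{i. i < n \<and> y \<in> B i}"] bexI[of _ y])
  qed
  finally show ?thesis by (simp add: S_def)
qed

lemma inner_regular_compact:
  fixes P :: "'a::polish_space measure"
  assumes "finite_measure P" and sP: "sets P = sets borel" and A: "A \<in> sets borel" and "0 < e"
  obtains K where "K \<subseteq> A" "compact K" "emeasure P (A - K) < ennreal e"
proof (rule ccontr)
  note thesis_if = that
  assume no_thesis: "\<not> thesis"
  interpret finite_measure P by fact
  have no_K: "\<not> emeasure P (A - K) < ennreal e" if "K \<subseteq> A" "compact K" for K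
    using no_thesis thesis_if that by blast
  have "emeasure P K \<le> ennreal (measure P A - e)" if K: "K \<subseteq> A" "compact K" for K
  proof -
    have "ennreal e \<le> emeasure P (A - K)" using no_K[OF K] by (simp only: not_less)
    then have "e \<le> measure P (A - K)"
      using \<open>0 < e\<close> by (simp add: emeasure_eq_measure)
    also have "\<dots> = measure P A - measure P K"
      using K A sP by (intro finite_measure_Diff) (auto intro: borel_compact)
    finally show ?thesis by (simp add: emeasure_eq_measure ennreal_leI)
  qed
  then have "emeasure P A \<le> ennreal (measure P A - e)"
    by (subst inner_regular[OF sP _ A]) (auto intro: SUP_least)
  then have "measure P A \<le> max 0 (measure P A - e)"
    using \<open>0 < e\<close> by (auto simp: emeasure_eq_measure ennreal_le_iff2)
  then have "measure P A = 0" using \<open>0 < e\<close> measure_nonneg[of P A] by linarith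
  then show False
    using no_K[of "{}"] \<open>0 < e\<close> by (simp add: emeasure_eq_measure)
qed

text \<open>
  This is Lusin's theorem for the map \<open>x \<mapsto> (\<lambda>i. x \<in> B i)\<close>: on \<open>K\<close> every \<open>B i\<close> is relatively clopen, that
  is, the map is continuous into the Cantor space.
\<close>

lemma compact_relatively_clopen:
  fixes P :: "'a::polish_space measure" and B :: "nat \<Rightarrow> 'a set"
  assumes "finite_measure P" and sP: "sets P = sets borel"
    and B: "\<And>i. B i \<in> sets borel" and A: "A \<in> sets borel" and "0 < e"
  obtains K where "compact K" "K \<subseteq> A" "\<And>i. compact (K \<inter> B i)" "\<And>i. compact (K - B i)"
    "emeasure P (A - K) \<le> ennreal e"
proof -
  interpret finite_measure P by fact
  note [measurable] = B A
  note [measurable_cong] = sP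
  \<comment> \<open>Half of \<open>e / 2 ^ Suc i\<close> for \<open>A \<inter> B i\<close> and half for \<open>A - B i\<close>; these errors add up to \<open>e\<close>.\<close>
  define d where "d i = e / 2 * (1/2) ^ Suc i" for i :: nat
  have d: "0 < d i" for i using \<open>0 < e\<close> by (simp add: d_def)
  have "\<exists>K. K \<subseteq> A \<inter> B i \<and> compact K \<and> emeasure P (A \<inter> B i - K) < ennreal (d i)" for i
    by (rule inner_regular_compact[OF assms(1) sP _ d[of i], of "A \<inter> B i"]) auto
  then obtain K1 where K1: "\<And>i. K1 i \<subseteq> A \<inter> B i" "\<And>i. compact (K1 i)"
    "\<And>i. emeasure P (A \<inter> B i - K1 i) < ennreal (d i)" by metis
  have "\<exists>K. K \<subseteq> A - B i \<and> compact K \<and> emeasure P (A - B i - K) < ennreal (d i)" for i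
    by (rule inner_regular_compact[OF assms(1) sP _ d[of i], of "A - B i"]) auto
  then obtain K2 where K2: "\<And>i. K2 i \<subseteq> A - B i" "\<And>i. compact (K2 i)"
    "\<And>i. emeasure P (A - B i - K2 i) < ennreal (d i)" by metis
  define K where "K = (\<Inter>i. K1 i \<union> K2 i)"
  have [measurable]: "K1 i \<in> sets borel" "K2 i \<in> sets borel" for i
    using K1 K2 by (auto intro: borel_compact)
  have "closed K" unfolding K_def by (intro closed_INT ballI closed_Un compact_imp_closed K1 K2)
  have "compact ((K1 0 \<union> K2 0) \<inter> K)"
    using K1 K2 \<open>closed K\<close> by (intro compact_Int_closed) auto
  also have "(K1 0 \<union> K2 0) \<inter> K = K" by (auto simp: K_def)
  finally have K: "compact K" .
  have "K \<inter> B i = K \<inter> K1 i" "K - B i = K \<inter> K2 i" for i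
    using K1(1)[of i] K2(1)[of i] by (auto simp: K_def)
  then have KB: "compact (K \<inter> B i)" "compact (K - B i)" for i
    using K K1 K2 by (auto intro: compact_Int)
  have "emeasure P (A - K) \<le> emeasure P (\<Union>i. (A \<inter> B i - K1 i) \<union> (A - B i - K2 i))"
    by (rule emeasure_mono) (auto simp: K_def)
  also have "\<dots> \<le> (\<Sum>i. emeasure P ((A \<inter> B i - K1 i) \<union> (A - B i - K2 i)))"
    by (rule emeasure_subadditive_countably) auto
  also have "\<dots> \<le> (\<Sum>i. ennreal (e * (1/2) ^ Suc i))"
  proof (rule suminf_le)
    fix i
    have "emeasure P ((A \<inter> B i - K1 i) \<union> (A - B i - K2 i)) \<le>
        emeasure P (A \<inter> B i - K1 i) + emeasure P (A - B i - K2 i)"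
      by (rule emeasure_subadditive) auto
    also have "\<dots> \<le> ennreal (d i) + ennreal (d i)"
      using K1(3)[of i] K2(3)[of i] by (intro add_mono) auto
    also have "\<dots> = ennreal (e * (1/2) ^ Suc i)"
      using \<open>0 < e\<close> by (simp add: d_def flip: ennreal_plus)
    finally show "emeasure P ((A \<inter> B i - K1 i) \<union> (A - B i - K2 i)) \<le> ennreal (e * (1/2) ^ Suc i)" .
  qed auto
  also have "\<dots> = ennreal (\<Sum>i. e * (1/2) ^ Suc i)"
    using \<open>0 < e\<close> by (intro suminf_ennreal2 summable_mult sums_summable[OF power_half_series]) auto
  also have "(\<Sum>i. e * (1/2) ^ Suc i) = e"
    using sums_unique[OF sums_mult[OF power_half_series, of e]] by simp
  finally have "emeasure P (A - K) \<le> ennreal e" .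
  moreover have "K \<subseteq> A" using K1(1)[of 0] K2(1)[of 0] by (auto simp: K_def)
  ultimately show thesis using that K KB by blast
qed

text \<open>
  Blackwell's theorem puts a saturated Borel set into the \<open>\<sigma>\<close>-algebra generated by \<open>B\<close>. Up to a null set
  this follows from inner regularity: \<open>A\<close> is exhausted by compact sets whose saturations are in that
  \<open>\<sigma>\<close>-algebra, and these saturations stay inside \<open>A\<close>.
\<close>

lemma saturated_AE_in_sigma_sets:
  fixes P :: "'a::polish_space measure" and B :: "nat \<Rightarrow> 'a set"
  assumes P: "finite_measure P" and sP: "sets P = sets borel"
    and B: "\<And>i. B i \<in> sets borel" and A: "A \<in> sets borel"
    and saturated: "\<And>x y. y \<in> A \<Longrightarrow> (\<And>i. x \<in> B i \<longleftrightarrow> y \<in> B i) \<Longrightarrow> x \<in> A"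
  obtains A' where "A' \<in> sigma_sets UNIV (range B)" "A' \<subseteq> A" "A - A' \<in> null_sets P"
proof -
  have "\<exists>K. compact K \<and> K \<subseteq> A \<and> (\<forall>i. compact (K \<inter> B i)) \<and> (\<forall>i. compact (K - B i))
      \<and> emeasure P (A - K) \<le> ennreal (inverse (real (Suc n)))" for n
  proof -
    have "0 < inverse (real (Suc n))" by simp
    then show ?thesis
    proof (rule compact_relatively_clopen[OF P sP B A])
      fix K assume "compact K" "K \<subseteq> A" "\<And>i. compact (K \<inter> B i)" "\<And>i. compact (K - B i)"
        "emeasure P (A - K) \<le> ennreal (inverse (real (Suc n)))"
      then show ?thesis by (intro exI[of _ K]) simp
    qed
  qed
  then obtain K where K: "\<And>n. compact (K n)" "\<And>n. K n \<subseteq> A" "\<And>n i. compact (K n \<inter> B i)"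
    "\<And>n i. compact (K n - B i)" "\<And>n. emeasure P (A - K n) \<le> ennreal (inverse (real (Suc n)))"
    by metis
  define H where "H n = {x. \<exists>y\<in>K n. \<forall>i. x \<in> B i \<longleftrightarrow> y \<in> B i}" for n
  have H: "H n \<in> sigma_sets UNIV (range B)" for n
    unfolding H_def using K by (intro compact_saturation_in_sigma_sets) auto
  then have U: "(\<Union>n. H n) \<in> sigma_sets UNIV (range B)" by (rule sigma_sets.Union)
  moreover have "sigma_sets UNIV (range B) \<subseteq> sets borel"
    using sets.sigma_sets_subset[of "range B" borel] B by auto
  ultimately have U': "(\<Union>n. H n) \<in> sets borel" by blast
  have "(\<Union>n. H n) \<subseteq> A" using K(2) saturated by (auto simp: H_def)
  moreover have "emeasure P (A - (\<Union>n. H n)) \<le> 0"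
  proof (rule LIMSEQ_le_const)
    show "(\<lambda>n. ennreal (inverse (real (Suc n)))) \<longlonglongrightarrow> 0"
      using tendsto_ennrealI[OF LIMSEQ_inverse_real_of_nat] by simp
    have "emeasure P (A - (\<Union>n. H n)) \<le> emeasure P (A - K n)" for n
      using K(1)[of n] A sP by (intro emeasure_mono) (auto simp: H_def intro: borel_compact)
    then show "\<exists>N. \<forall>n\<ge>N. emeasure P (A - (\<Union>n. H n)) \<le> ennreal (inverse (real (Suc n)))"
      using K(5) order_trans by blast
  qed
  ultimately show thesis using that[OF U] A U' sP by (auto simp: null_sets_def)
qed

section \<open>Asymptotic invariance of amenable averages\<close>

text \<open>
  The sum counts the multiples of \<open>1 / N\<close> in the interval from \<open>1 / N\<close> to \<open>\<phi> x\<close>, so the step function is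
  \<open>\<phi>\<close> rounded down to a multiple of \<open>1 / N\<close>.
\<close>

lemma step_function_approximation:
  fixes \<phi> :: "'a \<Rightarrow> real"
  assumes \<phi>: "\<And>x. 0 \<le> \<phi> x" "\<And>x. \<phi> x \<le> real C" and "0 < N"
  shows "\<bar>\<phi> x - (\<Sum>j=1..N * C. indicator {x. real j / real N \<le> \<phi> x} x) / real N\<bar> \<le> 1 / real N"
proof -
  define k where "k = nat \<lfloor>\<phi> x * real N\<rfloor>"
  have nonneg: "0 \<le> \<phi> x * real N" using \<phi> by simp
  have k: "real k \<le> \<phi> x * real N" "\<phi> x * real N < real k + 1"
    using nonneg unfolding k_def by linarith+
  have "real k \<le> real (N * C)" using k(1) mult_right_mono[OF \<phi>(2)[of x], of "real N"] by (simp add: mult.commute)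
  then have "k \<le> N * C" by (simp only: of_nat_le_iff)
  have "real j / real N \<le> \<phi> x \<longleftrightarrow> j \<le> k" for j
  proof -
    have "real j / real N \<le> \<phi> x \<longleftrightarrow> real j \<le> \<phi> x * real N"
      using \<open>0 < N\<close> by (simp add: divide_simps)
    also have "\<dots> \<longleftrightarrow> j \<le> k" using k by linarith
    finally show ?thesis .
  qed
  then have "(\<Sum>j=1..N * C. indicator {x. real j / real N \<le> \<phi> x} x :: real)
      = (\<Sum>j=1..N * C. if j \<in> {1..k} then 1 else 0)"
    by (intro sum.cong) (auto simp: indicator_def)
  also have "\<dots> = real k"
    using \<open>k \<le> N * C\<close> by (subst sum.inter_restrict[symmetric]) (auto simp: Int_absorb1)
  finally have "(\<Sum>j=1..N * C. indicator {x. real j / real N \<le> \<phi> x} x :: real) = real k" .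
  moreover have "\<phi> x - real k / real N = (\<phi> x * real N - real k) / real N"
    using \<open>0 < N\<close> by (simp add: field_simps)
  ultimately show ?thesis
    using k \<open>0 < N\<close> by (simp add: abs_le_iff divide_right_mono)
qed

text \<open>
  Amenability asserts the convergence for indicator functions, hence for step functions, and \<open>\<phi>\<close> is a
  uniform limit of step functions.
\<close>

lemma amenable_integral_shift_nonneg:
  fixes \<Psi> :: "nat \<Rightarrow> 'g::{topological_group_add, second_countable_topology} measure"
    and \<phi> :: "'g \<Rightarrow> real"
  assumes prob: "\<And>k. prob_space (\<Psi> k)" and sets: "\<And>k. sets (\<Psi> k) = sets borel"
    and shift: "\<And>B g. B \<in> sets borel \<Longrightarrow>
      (\<lambda>k. \<bar>measure (\<Psi> k) B - measure (\<Psi> k) ((\<lambda>h. h + g) ` B)\<bar>) \<longlonglongrightarrow> 0"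
    and [measurable]: "\<phi> \<in> borel_measurable borel" and \<phi>: "\<And>s. 0 \<le> \<phi> s" "\<And>s. \<phi> s \<le> real C"
  shows "(\<lambda>k. (\<integral>s. \<phi> (s + h) \<partial>\<Psi> k) - (\<integral>s. \<phi> s \<partial>\<Psi> k)) \<longlonglongrightarrow> 0"
proof -
  note [measurable_cong] = sets
  have [measurable]: "(\<lambda>s::'g. s + h) \<in> borel_measurable borel"
    by (intro borel_measurable_continuous_onI continuous_intros)
  have sp: "space (\<Psi> k) = UNIV" for k using sets_eq_imp_space_eq[OF sets[of k]] by simp
  define D where "D k = (\<integral>s. \<phi> (s + h) \<partial>\<Psi> k) - (\<integral>s. \<phi> s \<partial>\<Psi> k)" for k
  define B where "B N j = {s. real j / real N \<le> \<phi> s}" for N j :: nat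
  have B[measurable]: "B N j \<in> sets borel" for N j unfolding B_def by measurable
  define E where "E N k = (\<Sum>j=1..N * C. measure (\<Psi> k) ((\<lambda>s. s + h) -` B N j)
      - measure (\<Psi> k) (B N j)) / real N" for N k :: nat
  have E: "E N \<longlonglongrightarrow> 0" for N
  proof -
    have "(\<lambda>k. measure (\<Psi> k) ((\<lambda>s. s + h) -` B N j) - measure (\<Psi> k) (B N j)) \<longlonglongrightarrow> 0" for j
    proof -
      have "(\<lambda>s. s + h) -` B N j = (\<lambda>s. s + - h) ` B N j"
        by (auto simp: image_iff intro!: bexI[of _ "_ + h"])
      moreover have "(\<lambda>k. measure (\<Psi> k) (B N j) - measure (\<Psi> k) ((\<lambda>s. s + - h) ` B N j)) \<longlonglongrightarrow> 0"
        using shift[OF B[of N j]] by (rule tendsto_rabs_zero_cancel)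
      ultimately show ?thesis
        using tendsto_minus by fastforce
    qed
    then have "E N \<longlonglongrightarrow> (\<Sum>j=1..N * C. 0) / real N"
      unfolding E_def divide_inverse by (intro tendsto_intros)
    then show ?thesis by simp
  qed
  have DE: "\<bar>D k - E N k\<bar> \<le> 2 / real N" if "0 < N" for N k
  proof -
    interpret prob_space "\<Psi> k" by (rule prob)
    define F where "F s = (\<Sum>j=1..N * C. indicator (B N j) s) / real N" for s
    have [measurable]: "F \<in> borel_measurable borel" unfolding F_def by measurable
    have F: "\<bar>\<phi> s - F s\<bar> \<le> 1 / real N" for s
      using step_function_approximation[OF \<phi> that] by (simp add: F_def B_def)
    have int\<phi>: "integrable (\<Psi> k) (\<lambda>s. \<phi> (s + h))" "integrable (\<Psi> k) \<phi>"
      using \<phi> by (auto intro!: integrable_const_bound[of _ "real C"])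
    have [measurable]: "(\<lambda>s. s + h) -` B N j \<in> sets borel" for j
      using measurable_sets[of "\<lambda>s. s + h" borel borel "B N j"] by simp
    have F_eq: "F (s + h) = (\<Sum>j=1..N * C. indicator ((\<lambda>s. s + h) -` B N j) s) / real N" for s
      by (simp add: F_def indicator_def)
    have "\<bar>F s\<bar> \<le> real C + 1 / real N" for s
      using F[of s] \<phi>[of s] by linarith
    then have intF: "integrable (\<Psi> k) (\<lambda>s. F (s + h))" "integrable (\<Psi> k) F"
      by (auto intro!: integrable_const_bound[of _ "real C + 1 / real N"])
    have sums: "(\<integral>s. (\<Sum>j=1..N * C. indicator (A j) s) \<partial>\<Psi> k)
        = (\<Sum>j=1..N * C. measure (\<Psi> k) (A j))" if "\<And>j. A j \<in> sets borel" for A :: "nat \<Rightarrow> 'g set"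
      using that by (subst Bochner_Integration.integral_sum) (auto simp: sp sets emeasure_eq_measure)
    have "E N k = (\<integral>s. F (s + h) \<partial>\<Psi> k) - (\<integral>s. F s \<partial>\<Psi> k)"
      unfolding F_eq unfolding F_def E_def integral_divide_zero
      by (subst (1 2) sums) (auto simp: sum_subtractf diff_divide_distrib)
    then have "D k - E N k = (\<integral>s. \<phi> (s + h) - F (s + h) \<partial>\<Psi> k) - (\<integral>s. \<phi> s - F s \<partial>\<Psi> k)"
      using int\<phi> intF by (simp add: D_def)
    moreover have "\<bar>\<integral>s. \<phi> (s + h) - F (s + h) \<partial>\<Psi> k\<bar> \<le> 1 / real N"
      using int\<phi> intF F by (intro order_trans[OF integral_abs_bound] integral_le_const) auto
    moreover have "\<bar>\<integral>s. \<phi> s - F s \<partial>\<Psi> k\<bar> \<le> 1 / real N"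
      using int\<phi> intF F by (intro order_trans[OF integral_abs_bound] integral_le_const) auto
    ultimately show ?thesis by (simp add: abs_le_iff)
  qed
  have "D \<longlonglongrightarrow> 0"
  proof (rule LIMSEQ_I)
    fix e :: real assume "0 < e"
    obtain N :: nat where N: "4 / e < real N" using reals_Archimedean2 by blast
    then have "0 < N" using \<open>0 < e\<close> by (intro gr0I) auto
    then have "2 / real N < e / 2" using N \<open>0 < e\<close> by (simp add: field_simps)
    obtain K where "\<And>k. K \<le> k \<Longrightarrow> \<bar>E N k\<bar> < e / 2"
      using LIMSEQ_D[OF E[of N], of "e / 2"] \<open>0 < e\<close> by auto
    then have "\<bar>D k\<bar> < e" if "K \<le> k" for k
      using DE[OF \<open>0 < N\<close>, of k] \<open>2 / real N < e / 2\<close> that by fastforce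
    then show "\<exists>K. \<forall>k\<ge>K. norm (D k - 0) < e" by auto
  qed
  then show ?thesis by (simp add: D_def[abs_def])
qed

lemma amenable_integral_shift:
  fixes \<Psi> :: "nat \<Rightarrow> 'g::{topological_group_add, second_countable_topology} measure"
    and \<phi> :: "'g \<Rightarrow> real"
  assumes prob: "\<And>k. prob_space (\<Psi> k)" and sets: "\<And>k. sets (\<Psi> k) = sets borel"
    and shift: "\<And>B g. B \<in> sets borel \<Longrightarrow>
      (\<lambda>k. \<bar>measure (\<Psi> k) B - measure (\<Psi> k) ((\<lambda>h. h + g) ` B)\<bar>) \<longlonglongrightarrow> 0"
    and [measurable]: "\<phi> \<in> borel_measurable borel" and \<phi>: "\<And>s. \<bar>\<phi> s\<bar> \<le> C"
  shows "(\<lambda>k. (\<integral>s. \<phi> (s + h) \<partial>\<Psi> k) - (\<integral>s. \<phi> s \<partial>\<Psi> k)) \<longlonglongrightarrow> 0"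
proof -
  note [measurable_cong] = sets
  have [measurable]: "(\<lambda>s::'g. s + h) \<in> borel_measurable borel"
    by (intro borel_measurable_continuous_onI continuous_intros)
  obtain n :: nat where n: "C \<le> real n" using real_arch_simple by blast
  have \<phi>C: "0 \<le> \<phi> s + C" "\<phi> s + C \<le> real (2 * n)" for s
    using \<phi>[of s] n by (auto simp: abs_le_iff)
  have "(\<lambda>k. (\<integral>s. \<phi> (s + h) + C \<partial>\<Psi> k) - (\<integral>s. \<phi> s + C \<partial>\<Psi> k)) \<longlonglongrightarrow> 0"
    by (rule amenable_integral_shift_nonneg[OF prob sets shift _ \<phi>C]) auto
  moreover have "(\<integral>s. \<phi> (s + h) + C \<partial>\<Psi> k) - (\<integral>s. \<phi> s + C \<partial>\<Psi> k)
      = (\<integral>s. \<phi> (s + h) \<partial>\<Psi> k) - (\<integral>s. \<phi> s \<partial>\<Psi> k)" for k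
  proof -
    interpret prob_space "\<Psi> k" by (rule prob)
    have "integrable (\<Psi> k) (\<lambda>s. \<phi> (s + h))" "integrable (\<Psi> k) \<phi>"
      using \<phi> by (auto intro!: integrable_const_bound[of _ C])
    then show ?thesis by (simp add: prob_space)
  qed
  ultimately show ?thesis by simp
qed

section \<open>Almost everywhere convergence of convex combinations\<close>

text \<open>
  Choose \<open>F n \<in> D n\<close> of nearly minimal second moment. For \<open>m, n \<ge> N\<close> the midpoint of \<open>F m\<close> and \<open>F n\<close> lies
  in \<open>D N\<close>, so its second moment is at least the infimum \<open>d N\<close> over \<open>D N\<close>, and the parallelogram identity
  bounds the distance of \<open>F m\<close> and \<open>F n\<close>. As the increasing sequence \<open>d\<close> is bounded, \<open>F\<close> is Cauchy in
  \<open>L\<^sup>2\<close>, and a subsequence converges almost everywhere.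
\<close>

lemma (in prob_space) midpoint_closed_AE_convergent:
  fixes D :: "nat \<Rightarrow> ('a \<Rightarrow> real) set"
  assumes decreasing: "\<And>m n. m \<le> n \<Longrightarrow> D n \<subseteq> D m" and nonempty: "\<And>n. D n \<noteq> {}"
    and midpoint: "\<And>n F G. F \<in> D n \<Longrightarrow> G \<in> D n \<Longrightarrow> (\<lambda>x. (F x + G x) / 2) \<in> D n"
    and meas: "\<And>n F. F \<in> D n \<Longrightarrow> F \<in> borel_measurable M"
    and bound: "\<And>n F x. F \<in> D n \<Longrightarrow> \<bar>F x\<bar> \<le> C"
  obtains F where "\<And>n. F n \<in> D n" "AE x in M. convergent (\<lambda>n. F n x)"
proof -
  have sq_bound: "(F x)\<^sup>2 \<le> C\<^sup>2" if "F \<in> D n" for F n x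
    using power_mono[OF bound[OF that, of x], of 2] by simp
  have int: "integrable M F" if "F \<in> D n" for F n
    using meas[OF that] bound[OF that] by (intro integrable_const_bound[of _ C]) auto
  have int_sq: "integrable M (\<lambda>x. (F x)\<^sup>2)" if "F \<in> D n" for F n
    using meas[OF that] sq_bound[OF that] by (intro integrable_const_bound[of _ "C\<^sup>2"]) auto
  define J where "J F = (\<integral>x. (F x)\<^sup>2 \<partial>M)" for F :: "'a \<Rightarrow> real"
  have J: "0 \<le> J F" "J F \<le> C\<^sup>2" if "F \<in> D n" for F n
    using int_sq[OF that] sq_bound[OF that] unfolding J_def by (auto intro!: integral_le_const)
  define d where "d n = Inf (J ` D n)" for n
  have bdd: "bdd_below (J ` D n)" for n using J(1)[of _ n] by (auto intro!: bdd_belowI[of _ 0])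
  have d_le: "d n \<le> J F" if "F \<in> D n" for F n
    unfolding d_def using that bdd by (intro cInf_lower) auto
  have "incseq d"
    unfolding incseq_def d_def using decreasing bdd nonempty by (auto intro!: cInf_superset_mono)
  moreover have "d n \<le> C\<^sup>2" for n
    using nonempty[of n] d_le[of _ n] J(2)[of _ n] by (meson ex_in_conv order_trans)
  ultimately obtain l where l: "d \<longlonglongrightarrow> l" "\<forall>n. d n \<le> l"
    using incseq_convergent[of d "C\<^sup>2"] by blast
  have "\<exists>F\<in>D n. J F < d n + inverse (real (Suc n))" for n
    using cInf_lessD[of "J ` D n" "d n + inverse (real (Suc n))"] nonempty[of n]
    by (auto simp: d_def)
  then obtain F where F: "\<And>n. F n \<in> D n" "\<And>n. J (F n) < d n + inverse (real (Suc n))"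
    by metis
  have near: "(\<integral>x. (F m x - F n x)\<^sup>2 \<partial>M) \<le> 2 * (l - d N) + 4 * inverse (real (Suc N)) + 2 * (l - d N)"
    if "N \<le> m" "N \<le> n" for m n N
  proof -
    have FN: "F m \<in> D N" "F n \<in> D N" using F(1) decreasing that by blast+
    define G where "G x = (F m x + F n x) / 2" for x
    have GN: "G \<in> D N" unfolding G_def[abs_def] by (rule midpoint[OF FN])
    have "(\<integral>x. (F m x - F n x)\<^sup>2 \<partial>M) = (\<integral>x. 2 * (F m x)\<^sup>2 + 2 * (F n x)\<^sup>2 - 4 * (G x)\<^sup>2 \<partial>M)"
      by (rule arg_cong[where f = "integral\<^sup>L M"]) (auto simp: fun_eq_iff G_def power2_eq_square field_simps)
    also have "\<dots> = 2 * J (F m) + 2 * J (F n) - 4 * J G"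
      unfolding J_def using int_sq[OF FN(1)] int_sq[OF FN(2)] int_sq[OF GN] by simp
    also have "\<dots> \<le> 2 * J (F m) + 2 * J (F n) - 4 * d N"
      using d_le[OF GN] by simp
    also have "\<dots> \<le> 2 * (l + inverse (real (Suc N))) + 2 * (l + inverse (real (Suc N))) - 4 * d N"
    proof -
      have *: "J (F k) \<le> l + inverse (real (Suc N))" if "N \<le> k" for k
      proof -
        have "inverse (real (Suc k)) \<le> inverse (real (Suc N))" using that by (simp add: field_simps)
        then show ?thesis using F(2)[of k] l(2) by (smt (verit))
      qed
      show ?thesis using that by (intro diff_right_mono add_mono mult_left_mono *) auto
    qed
    finally show ?thesis by simp
  qed
  have "\<exists>N. \<forall>i\<ge>N. \<forall>j\<ge>N. (\<integral>x. norm (F i x - F j x) \<partial>M) < e" if "0 < e" for e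
  proof -
    have "(\<lambda>N. 2 * (l - d N) + 4 * inverse (real (Suc N)) + 2 * (l - d N))
        \<longlonglongrightarrow> 2 * (l - l) + 4 * 0 + 2 * (l - l)"
      by (intro tendsto_intros l LIMSEQ_inverse_real_of_nat)
    then have "eventually (\<lambda>N. 2 * (l - d N) + 4 * inverse (real (Suc N)) + 2 * (l - d N) < e\<^sup>2)
        sequentially"
      using \<open>0 < e\<close> by (intro order_tendstoD(2)) auto
    then obtain N where N: "2 * (l - d N) + 4 * inverse (real (Suc N)) + 2 * (l - d N) < e\<^sup>2"
      using eventually_happens'[OF sequentially_bot] by blast
    have "(\<integral>x. norm (F i x - F j x) \<partial>M) < e" if "N \<le> i" "N \<le> j" for i j
    proof -
      have [measurable]: "F n \<in> borel_measurable M" for n using F(1) meas by blast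
      have isq: "integrable M (\<lambda>x. (F i x - F j x)\<^sup>2)"
      proof (rule integrable_const_bound[of _ "(C + C)\<^sup>2"])
        show "AE x in M. norm ((F i x - F j x)\<^sup>2) \<le> (C + C)\<^sup>2"
        proof (rule AE_I2)
          fix x
          have "\<bar>F i x - F j x\<bar> \<le> C + C" using bound[OF F(1), of i x] bound[OF F(1), of j x] by linarith
          from power_mono[OF this, of 2] show "norm ((F i x - F j x)\<^sup>2) \<le> (C + C)\<^sup>2" by simp
        qed
      qed measurable
      \<comment> \<open>Young's inequality \<open>2 * e * t \<le> t\<^sup>2 + e\<^sup>2\<close> replaces the Cauchy-Schwarz inequality.\<close>
      have "(\<integral>x. norm (F i x - F j x) \<partial>M) \<le> (\<integral>x. ((F i x - F j x)\<^sup>2 + e\<^sup>2) / (2 * e) \<partial>M)"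
      proof (rule integral_mono)
        fix x
        have "0 \<le> (\<bar>F i x - F j x\<bar> - e)\<^sup>2" by simp
        then have "2 * e * \<bar>F i x - F j x\<bar> \<le> (F i x - F j x)\<^sup>2 + e\<^sup>2"
          by (simp add: power2_diff algebra_simps)
        then show "norm (F i x - F j x) \<le> ((F i x - F j x)\<^sup>2 + e\<^sup>2) / (2 * e)"
          using \<open>0 < e\<close> by (simp add: field_simps)
      qed (use isq int[OF F(1)] in auto)
      also have "\<dots> = ((\<integral>x. (F i x - F j x)\<^sup>2 \<partial>M) + e\<^sup>2) / (2 * e)"
        using isq by (simp add: prob_space)
      also have "\<dots> < (e\<^sup>2 + e\<^sup>2) / (2 * e)"
        using near[OF that] N \<open>0 < e\<close> by (intro divide_strict_right_mono) auto
      also have "\<dots> = e" using \<open>0 < e\<close> by (simp add: power2_eq_square)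
      finally show ?thesis .
    qed
    then show ?thesis by blast
  qed
  then obtain r :: "nat \<Rightarrow> nat" where r: "strict_mono r" "AE x in M. Cauchy (\<lambda>i. F (r i) x)"
    using int[OF F(1)] cauchy_L1_AE_cauchy_subseq[of M F] by metis
  have "F (r n) \<in> D n" for n
    using F(1)[of "r n"] decreasing[OF seq_suble[OF r(1), of n]] by blast
  moreover have "AE x in M. convergent (\<lambda>n. F (r n) x)"
    using r(2) by (simp add: Cauchy_convergent_iff)
  ultimately show thesis by (rule that)
qed

section \<open>Actions and invariant models\<close>

lemma measurable_act:
  fixes act :: "'g::{group_add, second_countable_topology} \<Rightarrow> 'a::second_countable_topology \<Rightarrow> 'a"
  assumes "continuous_action act" "f \<in> borel_measurable M" "g \<in> borel_measurable M"
  shows "(\<lambda>x. act (f x) (g x)) \<in> borel_measurable M"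
proof -
  have act: "(\<lambda>(s, x). act s x) \<in> borel_measurable (borel \<Otimes>\<^sub>M borel)"
    using assms(1) borel_measurable_continuous_onI
    unfolding continuous_action_def borel_prod by blast
  show ?thesis
    using measurable_compose[OF measurable_Pair[OF assms(2,3)] act] by simp
qed

lemma invariant_model_eq_distr:
  fixes act :: "'g::{group_add, second_countable_topology} \<Rightarrow> 'a::second_countable_topology \<Rightarrow> 'a"
  assumes action: "is_action act" and continuous: "continuous_action act"
    and P: "\<And>g. prob_space (P g) \<and> sets (P g) = sets borel" and invariant: "invariant_model act P"
  shows "P g = distr (P 0) borel (act g)"
proof (rule measure_eqI)
  interpret Pg: prob_space "P g" using P by blast
  interpret P0: prob_space "P 0" using P by blast
  have [measurable_cong]: "sets (P 0) = sets borel" using P by blast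
  have sp: "space (P 0) = UNIV" using P sets_eq_imp_space_eq[of "P 0" borel] by simp
  note [measurable (raw)] = measurable_act[OF continuous]
  fix C assume "C \<in> sets (P g)"
  then have [measurable]: "C \<in> sets borel" using P by blast
  define B where "B = act g -` C"
  have B[measurable]: "B \<in> sets borel"
    using measurable_sets[of "act g" borel borel C] by (simp add: B_def)
  have "act g ` B = C"
  proof safe
    fix x assume "x \<in> C"
    have "act g (act (- g) x) = x"
      using action unfolding is_action_def by (metis right_minus)
    then show "x \<in> act g ` B" using \<open>x \<in> C\<close> by (metis B_def image_eqI vimageI2)
  qed (simp add: B_def)
  then have "measure (P g) C = measure (P 0) B"
    using invariant B unfolding invariant_model_def by (metis add_0_right)
  then show "emeasure (P g) C = emeasure (distr (P 0) borel (act g)) C"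
    by (simp add: emeasure_distr Pg.emeasure_eq_measure P0.emeasure_eq_measure sp B_def)
qed (use P in simp)

text \<open>
  The action on samples is continuous if and only if the action on single observations is: embed an
  observation as a constant sample and read off one coordinate. The index type is therefore arbitrary.
\<close>

lemma continuous_action_componentwise_reindex:
  fixes act :: "'g::{group_add, topological_space} \<Rightarrow> 'x::topological_space \<Rightarrow> 'x"
  assumes "continuous_action (componentwise act :: 'g \<Rightarrow> ('k \<Rightarrow> 'x) \<Rightarrow> 'k \<Rightarrow> 'x)"
  shows "continuous_action (componentwise act :: 'g \<Rightarrow> ('n \<Rightarrow> 'x) \<Rightarrow> 'n \<Rightarrow> 'x)"
proof -
  let ?A = "\<lambda>gx :: 'g \<times> ('k \<Rightarrow> 'x). componentwise act (fst gx) (snd gx)"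
  have A: "continuous_on UNIV ?A"
    using assms by (simp add: continuous_action_def case_prod_unfold)
  have "continuous_on UNIV (\<lambda>gy :: 'g \<times> ('n \<Rightarrow> 'x). ?A (fst gy, \<lambda>_. snd gy i))" for i
    by (intro continuous_on_compose2[OF A] continuous_on_Pair continuous_on_fst continuous_on_id
        continuous_on_coordinatewise_then_product continuous_on_product_then_coordinatewise[OF continuous_on_snd])
      auto
  then have "continuous_on UNIV (\<lambda>gy :: 'g \<times> ('n \<Rightarrow> 'x). ?A (fst gy, \<lambda>_. snd gy i) undefined)" for i
    by (rule continuous_on_product_then_coordinatewise)
  then show ?thesis
    unfolding continuous_action_def case_prod_unfold componentwise_def
    by (intro continuous_on_coordinatewise_then_product) simp
qed


section \<open>Invariant limits of orbit averages\<close>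

text \<open>
  Midpoints suffice for the parallelogram identity, and properties that are preserved by midpoints
  are proved for the whole hull by induction.
\<close>

inductive_set midpoint_hull :: "('a \<Rightarrow> real) set \<Rightarrow> ('a \<Rightarrow> real) set" for \<L> where
  base: "L \<in> \<L> \<Longrightarrow> L \<in> midpoint_hull \<L>"
| midpoint: "F \<in> midpoint_hull \<L> \<Longrightarrow> G \<in> midpoint_hull \<L> \<Longrightarrow> (\<lambda>x. (F x + G x) / 2) \<in> midpoint_hull \<L>"

lemma midpoint_hull_mono:
  assumes "\<L> \<subseteq> \<L>'"
  shows "midpoint_hull \<L> \<subseteq> midpoint_hull \<L>'"
proof
  fix F assume "F \<in> midpoint_hull \<L>"
  then show "F \<in> midpoint_hull \<L>'"
    by induction (use assms in \<open>auto intro: midpoint_hull.intros\<close>)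
qed

lemma abs_midpoint_le: "\<bar>a\<bar> \<le> c \<Longrightarrow> \<bar>b\<bar> \<le> c \<Longrightarrow> \<bar>(a + b) / 2\<bar> \<le> (c :: real)"
  by (simp add: abs_le_iff)

lemma exp_midpoint_le: "exp ((a + b) / 2) \<le> (exp a + exp b) / (2 :: real)"
proof -
  have "exp ((a + b) / 2) = exp (a / 2) * exp (b / 2)" by (simp flip: exp_add add: add_divide_distrib)
  also have "\<dots> \<le> ((exp (a / 2))\<^sup>2 + (exp (b / 2))\<^sup>2) / 2"
    using sum_squares_bound[of "exp (a / 2)" "exp (b / 2)"] by simp
  also have "\<dots> = (exp a + exp b) / 2"
    by (simp add: power2_eq_square flip: exp_add)
  finally show ?thesis .
qed

lemma exp_integral_le:
  fixes \<phi> :: "'a \<Rightarrow> real"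
  assumes "prob_space M" and [measurable]: "\<phi> \<in> borel_measurable M" and \<phi>: "\<And>s. \<bar>\<phi> s\<bar> \<le> c"
  shows "exp (\<integral>s. \<phi> s \<partial>M) \<le> (\<integral>s. exp (\<phi> s) \<partial>M)"
proof -
  interpret prob_space M by fact
  define L where "L = (\<integral>s. \<phi> s \<partial>M)"
  have int: "integrable M \<phi>" "integrable M (\<lambda>s. exp (\<phi> s))"
    using \<phi> by (intro integrable_const_bound[of _ c] integrable_const_bound[of _ "exp c"];
        simp add: abs_le_iff)+
  have "exp L = (\<integral>s. exp L * (1 + (\<phi> s - L)) \<partial>M)"
    using int by (simp add: L_def prob_space)
  also have "\<dots> \<le> (\<integral>s. exp (\<phi> s) \<partial>M)"
  proof (rule integral_mono)
    fix s
    have "exp L * (1 + (\<phi> s - L)) \<le> exp L * exp (\<phi> s - L)"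
      by (intro mult_left_mono exp_ge_add_one_self) simp
    then show "exp L * (1 + (\<phi> s - L)) \<le> exp (\<phi> s)" by (simp flip: exp_add)
  qed (use int in auto)
  finally show ?thesis by (simp add: L_def)
qed

text \<open>
  The function \<open>\<phi>\<close> is made invariant without loss: \<open>f\<close> is an almost everywhere limit of convex combinations
  of the averages \<open>\<lambda>x. \<integral>s. \<phi> (act s x) \<partial>\<Psi> k\<close> over asymptotically invariant distributions \<open>\<Psi> k\<close>.
  Fubini's theorem turns the two assumptions on the translates of \<open>\<phi>\<close> into the same bounds for each
  average. Since \<open>F n (act h x) - F n x\<close> tends to \<open>0\<close> at every point, the limit is invariant everywhere and
  not merely almost everywhere.
\<close>

lemma orbit_averages_limit:
  fixes act :: "'g::{topological_group_add, second_countable_topology} \<Rightarrow> 'a::second_countable_topology \<Rightarrow> 'a"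
    and P Q :: "'a measure" and \<phi> :: "'a \<Rightarrow> real"
  assumes amenable: "amenable TYPE('g)"
    and action: "is_action act" and continuous: "continuous_action act"
    and P: "prob_space P" "sets P = sets borel" and Q: "prob_space Q" "sets Q = sets borel"
    and QP: "absolutely_continuous P Q"
    and \<phi>_measurable[measurable]: "\<phi> \<in> borel_measurable borel" and \<phi>: "\<And>x. \<bar>\<phi> x\<bar> \<le> c"
    and exp_\<phi>: "\<And>s. (\<integral>x. exp (\<phi> (act s x)) \<partial>P) \<le> 1"
    and v: "\<And>s. v \<le> (\<integral>x. \<phi> (act s x) \<partial>Q)"
  obtains f where "f \<in> borel_measurable borel" "\<And>x. \<bar>f x\<bar> \<le> c" "\<And>h x. f (act h x) = f x"
    "(\<integral>x. exp (f x) \<partial>P) \<le> 1" "v \<le> (\<integral>x. f x \<partial>Q)"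
proof -
  interpret P: prob_space P by (rule P(1))
  interpret Q: prob_space Q by (rule Q(1))
  note [measurable_cong] = P(2) Q(2)
  obtain \<Psi> :: "nat \<Rightarrow> 'g measure" where \<Psi>: "\<And>k. prob_space (\<Psi> k)" "\<And>k. sets (\<Psi> k) = sets borel"
    and shift: "\<And>B g. B \<in> sets borel \<Longrightarrow>
      (\<lambda>k. \<bar>measure (\<Psi> k) B - measure (\<Psi> k) ((\<lambda>h. h + g) ` B)\<bar>) \<longlonglongrightarrow> 0"
    using amenable unfolding amenable_def by blast
  note [measurable_cong] = \<Psi>(2)
  note [measurable (raw)] = measurable_act[OF continuous]
  have act_add: "act (s + h) x = act s (act h x)" for s h x
    using action by (simp add: is_action_def)
  have exp_bound: "exp t \<le> exp c" if "\<bar>t\<bar> \<le> c" for t :: real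
    using that by simp
  have c: "0 \<le> c" using \<phi>[of undefined] by linarith

  define L where "L k x = (\<integral>s. \<phi> (act s x) \<partial>\<Psi> k)" for k x
  have L_measurable[measurable]: "L k \<in> borel_measurable borel" for k
  proof -
    interpret \<Psi>: prob_space "\<Psi> k" by (rule \<Psi>)
    show ?thesis unfolding L_def by measurable
  qed
  have L_bound: "\<bar>L k x\<bar> \<le> c" for k x
  proof -
    interpret \<Psi>: prob_space "\<Psi> k" by (rule \<Psi>)
    have "integrable (\<Psi> k) (\<lambda>s. \<bar>\<phi> (act s x)\<bar>)"
      using \<phi> by (intro \<Psi>.integrable_const_bound[of _ c]) auto
    then show ?thesis
      unfolding L_def using \<phi> by (intro order_trans[OF integral_abs_bound] \<Psi>.integral_le_const) auto
  qed
  have L_exp: "(\<integral>x. exp (L k x) \<partial>P) \<le> 1" for k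
  proof -
    interpret \<Psi>: prob_space "\<Psi> k" by (rule \<Psi>)
    interpret pair: pair_prob_space "\<Psi> k" P ..
    have int: "integrable (\<Psi> k \<Otimes>\<^sub>M P) (\<lambda>(s, x). exp (\<phi> (act s x)))"
      using \<phi> exp_bound by (intro pair.P.integrable_const_bound[of _ "exp c"]) (auto intro!: AE_I2)
    have "(\<integral>x. exp (L k x) \<partial>P) \<le> (\<integral>x. (\<integral>s. exp (\<phi> (act s x)) \<partial>\<Psi> k) \<partial>P)"
    proof (rule integral_mono)
      show "integrable P (\<lambda>x. exp (L k x))"
        using L_bound exp_bound by (intro P.integrable_const_bound[of _ "exp c"]) auto
      show "integrable P (\<lambda>x. \<integral>s. exp (\<phi> (act s x)) \<partial>\<Psi> k)"
        using pair.integrable_snd[OF int] by simp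
      show "exp (L k x) \<le> (\<integral>s. exp (\<phi> (act s x)) \<partial>\<Psi> k)" for x
        unfolding L_def using \<phi> by (intro exp_integral_le[OF \<Psi>(1)]) auto
    qed
    also have "\<dots> = (\<integral>s. (\<integral>x. exp (\<phi> (act s x)) \<partial>P) \<partial>\<Psi> k)"
      using pair.Fubini_integral[OF int] by simp
    also have "\<dots> \<le> 1"
      using pair.integrable_fst[OF int] exp_\<phi> by (intro \<Psi>.integral_le_const) auto
    finally show ?thesis .
  qed
  have L_v: "v \<le> (\<integral>x. L k x \<partial>Q)" for k
  proof -
    interpret \<Psi>: prob_space "\<Psi> k" by (rule \<Psi>)
    interpret pair: pair_prob_space "\<Psi> k" Q ..
    have int: "integrable (\<Psi> k \<Otimes>\<^sub>M Q) (\<lambda>(s, x). \<phi> (act s x))"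
      using \<phi> by (intro pair.P.integrable_const_bound[of _ c]) (auto intro!: AE_I2)
    have "v \<le> (\<integral>s. (\<integral>x. \<phi> (act s x) \<partial>Q) \<partial>\<Psi> k)"
      using pair.integrable_fst[OF int] v by (intro \<Psi>.integral_ge_const) auto
    also have "\<dots> = (\<integral>x. L k x \<partial>Q)"
      using pair.Fubini_integral[OF int] by (simp add: L_def)
    finally show ?thesis .
  qed
  have L_shift: "(\<lambda>k. L k (act h x) - L k x) \<longlonglongrightarrow> 0" for h x
    using amenable_integral_shift[OF \<Psi> shift, of "\<lambda>s. \<phi> (act s x)" c h] \<phi>
    by (simp add: L_def act_add)

  define D where "D n = midpoint_hull (L ` {n..})" for n
  have D_properties: "F \<in> borel_measurable borel \<and> (\<forall>x. \<bar>F x\<bar> \<le> c) \<and> (\<integral>x. exp (F x) \<partial>P) \<le> 1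
      \<and> v \<le> (\<integral>x. F x \<partial>Q)" if "F \<in> D n" for F n
    using that unfolding D_def
  proof induction
    case (base F)
    then show ?case using L_bound L_exp L_v by auto
  next
    case (midpoint F G)
    then have [measurable]: "F \<in> borel_measurable borel" "G \<in> borel_measurable borel"
      and FG: "\<And>x. \<bar>F x\<bar> \<le> c" "\<And>x. \<bar>G x\<bar> \<le> c" by auto
    have FG': "\<bar>(F x + G x) / 2\<bar> \<le> c" for x by (rule abs_midpoint_le[OF FG])
    have "integrable P (\<lambda>x. exp (H x))" if [measurable]: "H \<in> borel_measurable borel"
      and "\<And>x. \<bar>H x\<bar> \<le> c" for H
      using exp_bound[OF that(2)] by (intro P.integrable_const_bound[of _ "exp c"]) auto
    from this[of F] this[of G] this[of "\<lambda>x. (F x + G x) / 2"]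
    have int: "integrable P (\<lambda>x. exp (F x))" "integrable P (\<lambda>x. exp (G x))"
      "integrable P (\<lambda>x. exp ((F x + G x) / 2))"
      using FG FG' by auto
    have int_Q: "integrable Q F" "integrable Q G"
      using FG by (intro Q.integrable_const_bound[of _ c]; simp)+
    have "(\<integral>x. exp ((F x + G x) / 2) \<partial>P) \<le> (\<integral>x. (exp (F x) + exp (G x)) / 2 \<partial>P)"
      using int by (intro integral_mono exp_midpoint_le) auto
    then show ?case using midpoint.IH int int_Q FG' by simp
  qed
  \<comment> \<open>An element of \<open>D n\<close> involves only averages from index \<open>n\<close> on, so it inherits their asymptotic invariance.\<close>
  have D_shift: "\<bar>F (act h x) - F x\<bar> \<le> e"
    if "F \<in> D n" "\<And>k. n \<le> k \<Longrightarrow> \<bar>L k (act h x) - L k x\<bar> \<le> e" for F n h x e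
    using that(1) unfolding D_def
  proof induction
    case (base F)
    then show ?case using that(2) by auto
  next
    case (midpoint F G)
    then show ?case using abs_midpoint_le[OF midpoint.IH] by (simp add: field_simps)
  qed
  obtain F where F: "\<And>n. F n \<in> D n" "AE x in P. convergent (\<lambda>n. F n x)"
  proof (rule P.midpoint_closed_AE_convergent[of D c])
    show "D n \<subseteq> D k" if "k \<le> n" for k n
      unfolding D_def using that by (intro midpoint_hull_mono) auto
    show "D n \<noteq> {}" for n
      unfolding D_def using midpoint_hull.base[of "L n" "L ` {n..}"] by auto
    show "(\<lambda>x. (F x + G x) / 2) \<in> D n" if "F \<in> D n" "G \<in> D n" for n F G
      using that unfolding D_def by (rule midpoint_hull.midpoint)
    show "F \<in> borel_measurable P" "\<bar>F x\<bar> \<le> c" if "F \<in> D n" for n F x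
      using D_properties[OF that] by auto
  qed blast
  have [measurable]: "F n \<in> borel_measurable borel" and F_bound: "\<bar>F n x\<bar> \<le> c"
    and F_exp: "(\<integral>x. exp (F n x) \<partial>P) \<le> 1" and F_v: "v \<le> (\<integral>x. F n x \<partial>Q)" for n x
    using D_properties[OF F(1)] by auto
  have F_shift: "(\<lambda>n. F n (act h x) - F n x) \<longlonglongrightarrow> 0" for h x
  proof (rule LIMSEQ_I)
    fix e :: real assume "0 < e"
    then obtain N where N: "\<And>k. N \<le> k \<Longrightarrow> \<bar>L k (act h x) - L k x\<bar> < e / 2"
      using LIMSEQ_D[OF L_shift[of h x], of "e / 2"] by auto
    have "\<bar>F n (act h x) - F n x\<bar> \<le> e / 2" if "N \<le> n" for n
      using N that by (intro D_shift[OF F(1)] less_imp_le) auto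
    then show "\<exists>N. \<forall>n\<ge>N. norm (F n (act h x) - F n x - 0) < e"
      using \<open>0 < e\<close> by (intro exI[of _ N]) fastforce
  qed
  \<comment> \<open>The limit is clipped because \<open>lim\<close> is an arbitrary number where the sequence diverges.\<close>
  define f where "f x = max (- c) (min c (lim (\<lambda>n. F n x)))" for x
  have [measurable]: "f \<in> borel_measurable borel" unfolding f_def by measurable
  have f_bound: "\<bar>f x\<bar> \<le> c" for x using c by (auto simp: f_def)
  have "lim (\<lambda>n. F n (act h x)) = lim (\<lambda>n. F n x)" for h x
  proof -
    have "(\<lambda>n. F n (act h x)) \<longlonglongrightarrow> l \<longleftrightarrow> (\<lambda>n. F n x) \<longlonglongrightarrow> l" for l
      using tendsto_add[OF F_shift[of h x], of "\<lambda>n. F n x" l]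
        tendsto_diff[OF _ F_shift[of h x], of "\<lambda>n. F n (act h x)" l]
      by auto
    then show ?thesis by (simp add: lim_def)
  qed
  then have f_invariant: "f (act h x) = f x" for h x by (simp add: f_def)
  have F_lim: "AE x in P. (\<lambda>n. F n x) \<longlonglongrightarrow> f x"
    using F(2)
  proof eventually_elim
    fix x assume "convergent (\<lambda>n. F n x)"
    then have lim: "(\<lambda>n. F n x) \<longlonglongrightarrow> lim (\<lambda>n. F n x)" by (simp add: convergent_LIMSEQ_iff)
    have "- c \<le> F n x" "F n x \<le> c" for n using F_bound[of n x] by linarith+
    then have "- c \<le> lim (\<lambda>n. F n x)" "lim (\<lambda>n. F n x) \<le> c"
      by (auto intro: LIMSEQ_le_const[OF lim] LIMSEQ_le_const2[OF lim])
    then show "(\<lambda>n. F n x) \<longlonglongrightarrow> f x" using lim by (simp add: f_def)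
  qed
  have F_lim_Q: "AE x in Q. (\<lambda>n. F n x) \<longlonglongrightarrow> f x"
    using absolutely_continuous_AE[OF _ QP F_lim] P Q by simp
  have "(\<lambda>n. \<integral>x. exp (F n x) \<partial>P) \<longlonglongrightarrow> (\<integral>x. exp (f x) \<partial>P)"
    by (rule integral_dominated_convergence[where w = "\<lambda>_. exp c"])
      (use F_lim F_bound exp_bound in \<open>auto intro: tendsto_exp\<close>)
  then have f_exp: "(\<integral>x. exp (f x) \<partial>P) \<le> 1"
    by (rule LIMSEQ_le_const2) (use F_exp in auto)
  have "(\<lambda>n. \<integral>x. F n x \<partial>Q) \<longlonglongrightarrow> (\<integral>x. f x \<partial>Q)"
    by (rule integral_dominated_convergence[where w = "\<lambda>_. c"])
      (use F_lim_Q F_bound in auto)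
  then have f_v: "v \<le> (\<integral>x. f x \<partial>Q)"
    by (rule LIMSEQ_le_const) (use F_v in auto)
  show thesis by (rule that[OF _ f_bound f_invariant f_exp f_v]) measurable
qed

section \<open>Likelihood ratio of a maximal invariant\<close>

locale invariant_likelihood_ratio =
  P: prob_space P + Q: prob_space Q
  for P Q :: "'a::polish_space measure" +
  fixes m :: "'a \<Rightarrow> 'm" and \<nu> :: "'m measure" and pM qM :: "'m \<Rightarrow> real"
  assumes sets_P[measurable_cong]: "sets P = sets borel" and sets_Q[measurable_cong]: "sets Q = sets borel"
    and Q_ac_P: "absolutely_continuous P Q"
    and m_measurable[measurable]: "m \<in> borel \<rightarrow>\<^sub>M \<nu>"
    and separated: "countably_separated (restrict_space \<nu> (range m))"
    and P_m: "distributed P \<nu> m (\<lambda>y. ennreal (pM y))" and pM_nonneg: "\<And>y. 0 \<le> pM y"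
    and Q_m: "distributed Q \<nu> m (\<lambda>y. ennreal (qM y))" and qM_nonneg: "\<And>y. 0 \<le> qM y"
begin

lemma pM_measurable[measurable]: "pM \<in> borel_measurable \<nu>"
  and qM_measurable[measurable]: "qM \<in> borel_measurable \<nu>"
  using distributed_borel_measurable[OF P_m] distributed_borel_measurable[OF Q_m] pM_nonneg qM_nonneg
  by (auto simp: borel_measurable_ennreal_iff)

lemma AE_P_imp_AE_Q: "AE x in P. R x \<Longrightarrow> AE x in Q. R x"
  using absolutely_continuous_AE[OF _ Q_ac_P] sets_P sets_Q by simp

text \<open>
  A countable family that separates the points of the range of \<open>m\<close> pulls back to Borel sets that separate
  the fibres of \<open>m\<close>; an invariant set is saturated for them.
\<close>

lemma invariant_set_AE_vimage:
  assumes A: "A \<in> sets borel" and invariant: "\<And>x y. m x = m y \<Longrightarrow> y \<in> A \<Longrightarrow> x \<in> A"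
  obtains N where "N \<in> sets \<nu>" "m -` N \<subseteq> A" "A - m -` N \<in> null_sets P"
proof -
  have m_space: "m x \<in> space \<nu>" for x using measurable_space[OF m_measurable] by simp
  have "space (restrict_space \<nu> (range m)) = range m"
    using m_space by (auto simp: space_restrict_space)
  then obtain \<A> where \<A>: "countable \<A>" "\<A> \<subseteq> sets (restrict_space \<nu> (range m))"
    and \<A>_eq: "\<And>y y'. y \<in> range m \<Longrightarrow> y' \<in> range m \<Longrightarrow> (\<forall>A\<in>\<A>. y \<in> A \<longleftrightarrow> y' \<in> A) \<Longrightarrow> y = y'"
    using separated unfolding countably_separated_def by metis
  \<comment> \<open>The empty set is added because \<open>\<A>\<close> may be empty, when it has no enumeration.\<close>
  define B where "B i = m -` from_nat_into (insert {} \<A>) i" for i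
  have enum: "range (from_nat_into (insert {} \<A>)) = insert {} \<A>"
    using \<A>(1) by (intro range_from_nat_into) auto
  have B_vimage: "B i \<in> sets (vimage_algebra UNIV m \<nu>)" for i
  proof -
    have "from_nat_into (insert {} \<A>) i \<in> sets (restrict_space \<nu> (range m))"
      using enum \<A>(2) by (metis (no_types, lifting) insert_iff rangeI sets.empty_sets subsetD)
    then obtain N where "N \<in> sets \<nu>" "from_nat_into (insert {} \<A>) i = range m \<inter> N"
      by (auto simp: sets_restrict_space)
    then have "B i = m -` N \<inter> UNIV" by (auto simp: B_def)
    then show ?thesis by (simp only: in_vimage_algebra[OF \<open>N \<in> sets \<nu>\<close>])
  qed
  have sets_vimage: "sets (vimage_algebra UNIV m \<nu>) = {m -` N |N. N \<in> sets \<nu>}"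
    by (subst sets_vimage_algebra2) (use m_space in simp_all)
  then have "B i \<in> sets borel" for i
    using B_vimage[of i] measurable_sets[OF m_measurable] by auto
  moreover have "x \<in> A" if "y \<in> A" "\<And>i. x \<in> B i \<longleftrightarrow> y \<in> B i" for x y
  proof (rule invariant[OF _ \<open>y \<in> A\<close>])
    show "m x = m y"
    proof (intro \<A>_eq ballI)
      fix A assume "A \<in> \<A>"
      then obtain i where "A = from_nat_into (insert {} \<A>) i" using enum by blast
      then show "m x \<in> A \<longleftrightarrow> m y \<in> A" using that(2)[of i] by (simp add: B_def)
    qed auto
  qed
  ultimately obtain A' where A': "A' \<in> sigma_sets UNIV (range B)" "A' \<subseteq> A" "A - A' \<in> null_sets P"
    using saturated_AE_in_sigma_sets[OF P.finite_measure_axioms sets_P _ A, of B] by metis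
  have "sigma_sets UNIV (range B) \<subseteq> sets (vimage_algebra UNIV m \<nu>)"
    using sets.sigma_sets_subset[of "range B" "vimage_algebra UNIV m \<nu>"] B_vimage by auto
  then obtain N where "N \<in> sets \<nu>" "A' = m -` N" using A'(1) sets_vimage by auto
  with A' show thesis using that by blast
qed

text \<open>
  Up to null sets, \<open>A\<close> is the preimage of a set \<open>N\<close>, and the two sides become integrals over \<open>N\<close> of
  \<open>qM * (pM / qM)\<close> and of \<open>pM\<close>. Where \<open>qM\<close> vanishes the former loses mass, hence only an inequality.
\<close>

lemma nn_integral_invariant_set_le:
  assumes A: "A \<in> sets borel" and invariant: "\<And>x y. m x = m y \<Longrightarrow> y \<in> A \<Longrightarrow> x \<in> A"
  shows "(\<integral>\<^sup>+x. indicator A x * ennreal (pM (m x) / qM (m x)) \<partial>Q) \<le> emeasure P A"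
proof -
  obtain N where N[measurable]: "N \<in> sets \<nu>" and NA: "m -` N \<subseteq> A" "A - m -` N \<in> null_sets P"
    by (rule invariant_set_AE_vimage[OF A invariant])
  have "AE x in P. x \<notin> A - m -` N" using NA(2) by (rule AE_not_in)
  then have "AE x in Q. x \<notin> A - m -` N" by (rule AE_P_imp_AE_Q)
  then have "AE x in Q. indicator A x = (indicator N (m x) :: ennreal)"
    by eventually_elim (use NA(1) in \<open>auto simp: indicator_def\<close>)
  then have "(\<integral>\<^sup>+x. indicator A x * ennreal (pM (m x) / qM (m x)) \<partial>Q)
      = (\<integral>\<^sup>+x. indicator N (m x) * ennreal (pM (m x) / qM (m x)) \<partial>Q)"
    by (intro nn_integral_cong_AE) auto
  also have "\<dots> = (\<integral>\<^sup>+y. ennreal (qM y) * (indicator N y * ennreal (pM y / qM y)) \<partial>\<nu>)"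
    by (rule distributed_nn_integral[OF Q_m, symmetric]) measurable
  also have "\<dots> \<le> (\<integral>\<^sup>+y. ennreal (pM y) * indicator N y \<partial>\<nu>)"
  proof (rule nn_integral_mono)
    fix y
    have "qM y * (pM y / qM y) \<le> pM y" using pM_nonneg[of y] by (cases "qM y = 0") auto
    then have "ennreal (qM y) * ennreal (pM y / qM y) \<le> ennreal (pM y)"
      by (simp add: ennreal_mult'[OF qM_nonneg, symmetric] ennreal_leI)
    then show "ennreal (qM y) * (indicator N y * ennreal (pM y / qM y)) \<le> ennreal (pM y) * indicator N y"
      by (auto simp: indicator_def)
  qed
  also have "\<dots> = emeasure P (m -` N \<inter> space P)"
    using distributed_emeasure[OF P_m N] by simp
  also have "\<dots> \<le> emeasure P A"
    using NA A by (intro emeasure_mono) (auto simp: sets_P)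
  finally show ?thesis .
qed

lemma nn_integral_invariant_le:
  fixes u :: "'a \<Rightarrow> ennreal"
  assumes u: "u \<in> borel_measurable borel" and invariant: "\<And>x y. m x = m y \<Longrightarrow> u x = u y"
  shows "(\<integral>\<^sup>+x. u x * ennreal (pM (m x) / qM (m x)) \<partial>Q) \<le> (\<integral>\<^sup>+x. u x \<partial>P)"
proof -
  define \<I> where "\<I> = {A \<in> sets borel. \<forall>x y. m x = m y \<longrightarrow> y \<in> A \<longrightarrow> x \<in> A}"
  have "sigma_algebra UNIV \<I>"
    unfolding sigma_algebra_iff2 by (auto simp: \<I>_def Compl_eq_Diff_UNIV[symmetric]) (metis+)
  then have sets_I: "sets (sigma UNIV \<I>) = \<I>"
    by (simp add: sigma_algebra.sigma_sets_eq)
  have I_borel: "f \<in> borel_measurable borel" if "f \<in> borel_measurable (sigma UNIV \<I>)"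
    for f :: "'a \<Rightarrow> ennreal"
    using that by (rule measurable_mono[THEN subsetD, rotated -1]) (auto simp only: sets_I, auto simp: \<I>_def)
  have "u \<in> borel_measurable (sigma UNIV \<I>)"
  proof (rule measurableI)
    fix S :: "ennreal set" assume "S \<in> sets borel"
    then have "u -` S \<in> sets borel" using measurable_sets[OF u] by simp
    then show "u -` S \<inter> space (sigma UNIV \<I>) \<in> sets (sigma UNIV \<I>)"
      unfolding sets_I by (simp add: \<I>_def) (metis invariant)
  qed simp
  then show ?thesis
  proof (induction rule: borel_measurable_induct)
    case (cong f g)
    then show ?case by (simp add: space_measure_of_conv cong: nn_integral_cong)
  next
    case (set A)
    then show ?case
      using nn_integral_invariant_set_le[of A] unfolding sets_I by (auto simp: \<I>_def sets_P)
  next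
    case (mult f c)
    then have [measurable]: "f \<in> borel_measurable borel" by (intro I_borel)
    show ?case using mult.IH
      by (simp add: mult.assoc nn_integral_cmult mult_left_mono)
  next
    case (add f g)
    then have [measurable]: "f \<in> borel_measurable borel" "g \<in> borel_measurable borel"
      by (auto intro: I_borel)
    show ?case using add.IH
      by (simp add: distrib_right nn_integral_add add_mono)
  next
    case (seq U)
    then have [measurable]: "U i \<in> borel_measurable borel" for i by (intro I_borel)
    have "(\<integral>\<^sup>+x. (SUP i. U i) x * ennreal (pM (m x) / qM (m x)) \<partial>Q)
        = (\<integral>\<^sup>+x. (SUP i. U i x * ennreal (pM (m x) / qM (m x))) \<partial>Q)"
      by (simp add: image_comp SUP_mult_right_ennreal)
    also have "\<dots> = (SUP i. \<integral>\<^sup>+x. U i x * ennreal (pM (m x) / qM (m x)) \<partial>Q)"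
      using seq by (intro nn_integral_monotone_convergence_SUP)
        (auto simp: incseq_def le_fun_def intro!: mult_right_mono)
    also have "\<dots> \<le> (SUP i. \<integral>\<^sup>+x. U i x \<partial>P)"
      using seq by (intro SUP_mono') auto
    also have "\<dots> = (\<integral>\<^sup>+x. (SUP i. U i x) \<partial>P)"
      using seq by (intro nn_integral_monotone_convergence_SUP[symmetric]) auto
    finally show ?case by (simp add: image_comp)
  qed
qed

lemma AE_Q_ratio_pos: "AE x in Q. 0 < qM (m x) / pM (m x)"
proof -
  have pos: "AE x in M. 0 < f (m x)"
    if "distributed M \<nu> m (\<lambda>y. ennreal (f y))" "\<And>y. 0 \<le> f y" for M :: "'a measure" and f
  proof -
    have [measurable]: "m \<in> M \<rightarrow>\<^sub>M \<nu>" "f \<in> borel_measurable \<nu>"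
      using distributed_measurable[OF that(1)] distributed_borel_measurable[OF that(1)] that(2)
      by (auto simp: borel_measurable_ennreal_iff)
    have "AE y in density \<nu> (\<lambda>y. ennreal (f y)). 0 < f y"
      using that(2) by (subst AE_density) (auto simp: ennreal_eq_0_iff not_le less_le)
    then have "AE y in distr M \<nu> m. 0 < f y"
      unfolding distributed_distr_eq_density[OF that(1)] .
    then show ?thesis by (subst (asm) AE_distr_iff) auto
  qed
  show ?thesis
    using pos[OF Q_m qM_nonneg] AE_P_imp_AE_Q[OF pos[OF P_m pM_nonneg]]
    by eventually_elim simp
qed

text \<open>
  Gibbs' variational inequality for the relative entropy of the distributions of \<open>m\<close>: with
  \<open>w = exp f * pM / qM\<close>, integrate \<open>ln w \<le> w - 1\<close> with respect to \<open>Q\<close>.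
\<close>

lemma invariant_log_expectation_le:
  fixes f :: "'a \<Rightarrow> real"
  assumes [measurable]: "f \<in> borel_measurable borel" and invariant: "\<And>x y. m x = m y \<Longrightarrow> f x = f y"
    and int_f: "integrable Q f" and f: "(\<integral>\<^sup>+x. ennreal (exp (f x)) \<partial>P) \<le> 1"
    and int_T: "integrable Q (\<lambda>x. ln (qM (m x) / pM (m x)))"
  shows "(\<integral>x. f x \<partial>Q) \<le> (\<integral>x. ln (qM (m x) / pM (m x)) \<partial>Q)"
proof -
  define w where "w x = exp (f x) * (pM (m x) / qM (m x))" for x
  have [measurable]: "w \<in> borel_measurable borel" unfolding w_def by measurable
  have w_nonneg: "0 \<le> w x" for x using pM_nonneg qM_nonneg by (simp add: w_def)
  have "(\<integral>\<^sup>+x. ennreal (w x) \<partial>Q) = (\<integral>\<^sup>+x. ennreal (exp (f x)) * ennreal (pM (m x) / qM (m x)) \<partial>Q)"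
    by (simp add: w_def ennreal_mult'[symmetric])
  also have "\<dots> \<le> (\<integral>\<^sup>+x. ennreal (exp (f x)) \<partial>P)"
    by (rule nn_integral_invariant_le) (auto dest: invariant)
  finally have w1: "(\<integral>\<^sup>+x. ennreal (w x) \<partial>Q) \<le> 1" using f by simp
  have int_w: "integrable Q w"
    by (rule integrableI_nonneg) (use order.strict_trans1[OF w1 ennreal_one_less_top] w_nonneg in auto)
  have w_le: "(\<integral>x. w x \<partial>Q) \<le> 1"
    using w1 nn_integral_eq_integral[OF int_w] w_nonneg by simp
  have "(\<integral>x. f x - ln (qM (m x) / pM (m x)) \<partial>Q) \<le> (\<integral>x. w x - 1 \<partial>Q)"
  proof (rule integral_mono_AE)
    show "AE x in Q. f x - ln (qM (m x) / pM (m x)) \<le> w x - 1"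
      using AE_Q_ratio_pos
    proof eventually_elim
      fix x assume pos: "0 < qM (m x) / pM (m x)"
      have "exp (f x) / (qM (m x) / pM (m x)) = w x" by (simp add: w_def)
      then have "ln (w x) = f x - ln (qM (m x) / pM (m x))" "0 < w x"
        using pos ln_div[of "exp (f x)" "qM (m x) / pM (m x)"]
          divide_pos_pos[OF exp_gt_zero[of "f x"] pos] by auto
      then show "f x - ln (qM (m x) / pM (m x)) \<le> w x - 1"
        using ln_le_minus_one[of "w x"] by simp
    qed
  qed (use int_f int_T int_w in auto)
  then show ?thesis
    using int_f int_T int_w w_le by (simp add: Q.prob_space)
qed

end

section \<open>Growth optimality\<close>

lemma density_ratio:
  fixes p q :: "'a \<Rightarrow> real"
  assumes [measurable]: "p \<in> borel_measurable \<mu>" "q \<in> borel_measurable \<mu>"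
    and "\<And>x. 0 \<le> p x" "\<And>x. 0 \<le> q x" and support: "\<And>x. 0 < q x \<Longrightarrow> 0 < p x"
  shows "density \<mu> (\<lambda>x. ennreal (q x)) = density (density \<mu> (\<lambda>x. ennreal (p x))) (\<lambda>x. ennreal (q x / p x))"
proof -
  have "p x * (q x / p x) = q x" for x
    using support[of x] assms(4)[of x] by (cases "p x = 0") (auto simp: less_le)
  then have "ennreal (p x) * ennreal (q x / p x) = ennreal (q x)" for x
    using assms(3)[of x] by (simp add: ennreal_mult'[symmetric])
  then show ?thesis by (simp add: density_density_eq)
qed

lemma INF_minus_le:
  fixes a :: "'g \<Rightarrow> ereal"
  assumes "(INF g. a g) \<le> k" and "\<bar>s\<bar> \<noteq> \<infinity>"
  shows "(INF g. a g - s) \<le> k - s"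
proof -
  have "(INF g. a g - s) + s \<le> a g" for g
    using INF_lower[of g UNIV "\<lambda>g. a g - s"] assms(2) by (simp add: ereal_le_minus)
  then have "(INF g. a g - s) + s \<le> (INF g. a g)" by (rule INF_greatest)
  then show ?thesis using assms by (simp add: ereal_le_minus)
qed

text \<open>
  The models enter through their members \<open>P\<close> and \<open>Q\<close> at the unit element, of which all others are
  images under the action.
\<close>

locale invariant_testing_problem = invariant_likelihood_ratio P Q m \<nu> pM qM
  for P Q :: "'a::polish_space measure" and m :: "'a \<Rightarrow> 'm" and \<nu> pM qM +
  fixes act :: "'g::{topological_group_add, second_countable_topology} \<Rightarrow> 'a \<Rightarrow> 'a"
    and r :: "'a \<Rightarrow> real"
  assumes amenable: "amenable TYPE('g)" and action: "is_action act"
    and continuous: "continuous_action act" and maximal: "maximally_invariant act m"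
    and r_measurable[measurable]: "r \<in> borel_measurable borel" and r_nonneg: "\<And>x. 0 \<le> r x"
    and Q_density: "Q = density P (\<lambda>x. ennreal (r x))"
    and integrable_ln_r: "integrable Q (\<lambda>x. ln (r x))"
    and integrable_ln_ratio: "integrable Q (\<lambda>x. ln (qM (m x) / pM (m x)))"
begin

abbreviation ratio :: "'a \<Rightarrow> real" where "ratio x \<equiv> qM (m x) / pM (m x)"

lemmas act_measurable[measurable (raw)] = measurable_act[OF continuous]

lemma act_add: "act (g + h) x = act g (act h x)" and act_0: "act 0 x = x"
  using action by (auto simp: is_action_def)

lemma m_act: "m (act g x) = m x"
  using maximal unfolding maximally_invariant_def by blast

text \<open>
  After truncation with error below \<open>\<eta>\<close>, the logarithm \<open>\<phi>\<close> of \<open>T\<close> is bounded and may be replaced by the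
  invariant limit \<open>f\<close> of its orbit averages, whose expectation is bounded by Gibbs' inequality.
\<close>

lemma worst_case_growth_le:
  assumes [measurable]: "T \<in> borel_measurable borel" and T: "\<And>x. 0 \<le> T x"
    and ET: "\<And>g. (\<integral>\<^sup>+x. ennreal (T (act g x)) \<partial>P) \<le> 1"
  shows "(INF g. expected_log Q (\<lambda>x. T (act g x))) \<le> ereal (\<integral>x. ln (ratio x) \<partial>Q)"
proof (rule ereal_le_epsilon2)
  fix \<eta> :: real assume "0 < \<eta>"
  let ?I = "INF g. expected_log Q (\<lambda>x. T (act g x))"
  obtain c \<delta> where \<delta>: "0 < \<delta>" "\<delta> < 1"
    and err: "exp (- c) + (\<integral>x. max 0 (ln (r x) - c) \<partial>Q) - ln (1 - \<delta>) < \<eta>"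
    by (rule truncation_error_vanishes[OF integrable_ln_r \<open>0 < \<eta>\<close>])
  define V where "V x = (1 - \<delta>) * T x + \<delta>" for x
  have V: "\<delta> \<le> V x" for x using T \<delta> by (simp add: V_def)
  define \<phi> where "\<phi> x = ln (min (exp (2 * c)) (V x))" for x
  have [measurable]: "V \<in> borel_measurable borel" unfolding V_def by measurable
  have \<phi>_measurable[measurable]: "\<phi> \<in> borel_measurable borel" unfolding \<phi>_def by measurable
  have \<phi>: "\<bar>\<phi> x\<bar> \<le> \<bar>2 * c\<bar> + \<bar>ln \<delta>\<bar>" for x
    unfolding \<phi>_def by (rule abs_ln_truncated_le[OF \<delta>(1) V])
  have exp_\<phi>: "exp (\<phi> x) \<le> V x" for x
    using V[of x] \<delta> by (simp add: \<phi>_def)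
  have \<phi>_int: "(\<integral>x. exp (\<phi> (act g x)) \<partial>P) \<le> 1" for g
  proof -
    have "(\<integral>\<^sup>+x. ennreal (exp (\<phi> (act g x))) \<partial>P) \<le> (\<integral>\<^sup>+x. ennreal (V (act g x)) \<partial>P)"
      by (intro nn_integral_mono ennreal_leI exp_\<phi>)
    also have "\<dots> \<le> 1"
      unfolding V_def by (rule P.nn_integral_mixture_le) (use T ET \<delta> in auto)
    finally have "(\<integral>\<^sup>+x. ennreal (exp (\<phi> (act g x))) \<partial>P) \<le> 1" .
    then have "enn2real (\<integral>\<^sup>+x. ennreal (exp (\<phi> (act g x))) \<partial>P) \<le> 1"
      by (intro enn2real_leI) auto
    then show ?thesis by (subst integral_eq_nn_integral) auto
  qed
  have I_le: "?I \<le> ereal ((\<integral>x. \<phi> (act g x) \<partial>Q) + \<eta>)" for g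
  proof -
    have "?I \<le> expected_log Q (\<lambda>x. T (act g x))" by (rule INF_lower) simp
    also have "\<dots> \<le> ereal ((\<integral>x. \<phi> (act g x) \<partial>Q)
        + (exp (- c) + (\<integral>x. max 0 (ln (r x) - c) \<partial>Q) - ln (1 - \<delta>)))"
      unfolding \<phi>_def V_def
      by (rule expected_log_le_truncated[OF P.prob_space_axioms Q.prob_space_axioms Q_density _ _
            r_nonneg integrable_ln_r _ ET \<delta>]) (use T in auto)
    also have "\<dots> \<le> ereal ((\<integral>x. \<phi> (act g x) \<partial>Q) + \<eta>)" using err by simp
    finally show ?thesis .
  qed
  show "?I \<le> ereal (\<integral>x. ln (ratio x) \<partial>Q) + ereal \<eta>"
  proof (cases ?I)
    case (real i)
    have v: "i - \<eta> \<le> (\<integral>x. \<phi> (act g x) \<partial>Q)" for g using I_le[of g] real by simp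
    obtain f where f_measurable[measurable]: "f \<in> borel_measurable borel"
      and f: "\<And>x. \<bar>f x\<bar> \<le> \<bar>2 * c\<bar> + \<bar>ln \<delta>\<bar>" "\<And>h x. f (act h x) = f x"
        "(\<integral>x. exp (f x) \<partial>P) \<le> 1" "i - \<eta> \<le> (\<integral>x. f x \<partial>Q)"
    proof (rule orbit_averages_limit[OF amenable action continuous P.prob_space_axioms sets_P
            Q.prob_space_axioms sets_Q Q_ac_P \<phi>_measurable \<phi> \<phi>_int v])
      fix f :: "'a \<Rightarrow> real"
      assume "f \<in> borel_measurable borel" "\<And>x. \<bar>f x\<bar> \<le> \<bar>2 * c\<bar> + \<bar>ln \<delta>\<bar>" "\<And>h x. f (act h x) = f x"
        "(\<integral>x. exp (f x) \<partial>P) \<le> 1" "i - \<eta> \<le> (\<integral>x. f x \<partial>Q)"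
      then show thesis by (rule that)
    qed
    have "integrable P (\<lambda>x. exp (f x))"
      using f(1) by (intro P.integrable_const_bound[of _ "exp (\<bar>2 * c\<bar> + \<bar>ln \<delta>\<bar>)"])
        (auto simp: abs_le_iff)
    then have f_exp: "(\<integral>\<^sup>+x. ennreal (exp (f x)) \<partial>P) \<le> 1"
      using f(3) by (simp add: nn_integral_eq_integral)
    have f_m: "f x = f y" if "m x = m y" for x y
      using maximal f(2) that unfolding maximally_invariant_def by metis
    have f_int: "integrable Q f"
      using f(1) by (intro Q.integrable_const_bound[of _ "\<bar>2 * c\<bar> + \<bar>ln \<delta>\<bar>"]) auto
    have "(\<integral>x. f x \<partial>Q) \<le> (\<integral>x. ln (ratio x) \<partial>Q)"
      by (rule invariant_log_expectation_le[OF f_measurable f_m f_int f_exp integrable_ln_ratio])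
    then show ?thesis using f(4) real by simp
  qed (use I_le[of 0] in auto)
qed

lemma nn_integral_ratio_le: "(\<integral>\<^sup>+x. ennreal (ratio x) \<partial>P) \<le> 1"
proof -
  have "(\<integral>\<^sup>+x. ennreal (ratio x) \<partial>P) = (\<integral>\<^sup>+y. ennreal (pM y) * ennreal (qM y / pM y) \<partial>\<nu>)"
    by (rule distributed_nn_integral[OF P_m, symmetric]) measurable
  also have "\<dots> \<le> (\<integral>\<^sup>+y. ennreal (qM y) * 1 \<partial>\<nu>)"
  proof (rule nn_integral_mono)
    fix y
    have "pM y * (qM y / pM y) \<le> qM y" using qM_nonneg[of y] by (cases "pM y = 0") auto
    then show "ennreal (pM y) * ennreal (qM y / pM y) \<le> ennreal (qM y) * 1"
      by (simp add: ennreal_mult'[OF pM_nonneg, symmetric] ennreal_leI)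
  qed
  also have "\<dots> = (\<integral>\<^sup>+x. 1 \<partial>Q)"
    by (rule distributed_nn_integral[OF Q_m]) simp
  finally show ?thesis by (simp add: Q.emeasure_space_1)
qed

lemma expected_log_ratio: "expected_log Q ratio = ereal (\<integral>x. ln (ratio x) \<partial>Q)"
  by (rule expected_log_real[OF AE_Q_ratio_pos integrable_ln_ratio])

text \<open>
  This bound is the same for all e-statistics and makes the oracle growth rate finite.
\<close>

lemma expected_log_le:
  assumes [measurable]: "U \<in> borel_measurable borel"
    and U: "\<And>x. 0 \<le> U x" "(\<integral>\<^sup>+x. ennreal (U x) \<partial>P) \<le> 1"
  shows "expected_log Q U \<le> ereal (1 + (\<integral>x. max 0 (ln (r x)) \<partial>Q) - ln (1 / 2))"
proof -
  \<comment> \<open>For \<open>c = 0\<close> the truncated statistic is at most \<open>1\<close>, so its logarithm contributes nothing positive.\<close>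
  have "expected_log Q U \<le> ereal ((\<integral>x. ln (min (exp (2 * 0)) ((1 - 1/2) * U x + 1/2)) \<partial>Q)
      + (exp (- 0) + (\<integral>x. max 0 (ln (r x) - 0) \<partial>Q) - ln (1 - 1/2)))"
    by (rule expected_log_le_truncated[OF P.prob_space_axioms Q.prob_space_axioms Q_density _ _
          r_nonneg integrable_ln_r U]) auto
  also have "(\<integral>x. ln (min (exp (2 * 0)) ((1 - 1/2) * U x + 1/2)) \<partial>Q) \<le> 0"
  proof -
    have "0 \<le> (\<integral>x. - ln (min (exp (2 * 0)) ((1 - 1/2) * U x + 1/2)) \<partial>Q)"
      using U(1) by (intro integral_nonneg_AE AE_I2) (simp add: min_def add_nonneg_pos)
    then show ?thesis by simp
  qed
  finally show ?thesis by simp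
qed

lemma ratio_GROW_and_relatively_GROW:
  fixes P' Q' :: "'g \<Rightarrow> 'a measure"
  assumes P': "\<And>g. P' g = distr P borel (act g)" and Q': "\<And>g. Q' g = distr Q borel (act g)"
  shows "GROW P' Q' ratio" "relatively_GROW P' Q' ratio"
proof -
  have e_stat: "e_statistic P' T \<longleftrightarrow> T \<in> borel_measurable borel \<and> (\<forall>x. 0 \<le> T x) \<and>
      (\<forall>g. (\<integral>\<^sup>+x. ennreal (T (act g x)) \<partial>P) \<le> 1)" for T
    unfolding e_statistic_def SUP_le_iff P' by (auto simp: nn_integral_distr)
  have E_Q': "expected_log (Q' g) T = expected_log Q (\<lambda>x. T (act g x))"
    if "T \<in> borel_measurable borel" for g T
    unfolding Q' using that by (intro expected_log_distr) measurable
  have ratio: "e_statistic P' ratio"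
    unfolding e_stat m_act using nn_integral_ratio_le pM_nonneg qM_nonneg by auto
  have E_ratio: "expected_log (Q' g) ratio = ereal (\<integral>x. ln (ratio x) \<partial>Q)" for g
    by (subst E_Q') (auto simp: m_act expected_log_ratio)
  have growth: "(INF g. expected_log (Q' g) T) \<le> ereal (\<integral>x. ln (ratio x) \<partial>Q)"
    if "e_statistic P' T" for T
    using worst_case_growth_le[of T] that by (simp add: e_stat E_Q')
  show "GROW P' Q' ratio"
    unfolding GROW_def using ratio growth by (simp add: E_ratio)
  \<comment> \<open>The oracle growth rate under \<open>Q' 0\<close>; translating e-statistics shows that it is the one under every \<open>Q' g\<close>.\<close>
  define S where "S = (SUP T\<in>{T. e_statistic P' T}. expected_log Q T)"
  have translate: "e_statistic P' (\<lambda>x. T (act h x))" if "e_statistic P' T" for T h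
    using that unfolding e_stat by (auto simp flip: act_add)
  have S_eq: "(SUP T\<in>{T. e_statistic P' T}. expected_log (Q' g) T) = S" for g
  proof (rule antisym)
    show "(SUP T\<in>{T. e_statistic P' T}. expected_log (Q' g) T) \<le> S"
    proof (intro SUP_least)
      fix T assume "T \<in> {T. e_statistic P' T}"
      then have T: "e_statistic P' T" by simp
      then have "expected_log (Q' g) T = expected_log Q (\<lambda>x. T (act g x))"
        by (intro E_Q') (simp add: e_stat)
      also have "\<dots> \<le> S"
        unfolding S_def using translate[OF T] by (intro SUP_upper) simp
      finally show "expected_log (Q' g) T \<le> S" .
    qed
    show "S \<le> (SUP T\<in>{T. e_statistic P' T}. expected_log (Q' g) T)"
      unfolding S_def
    proof (intro SUP_least)
      fix T assume "T \<in> {T. e_statistic P' T}"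
      then have T: "e_statistic P' T" by simp
      then have [measurable]: "T \<in> borel_measurable borel" by (simp add: e_stat)
      have "expected_log Q T = expected_log (Q' g) (\<lambda>x. T (act (- g) x))"
        by (subst E_Q') (simp_all add: act_0 flip: act_add)
      also have "\<dots> \<le> (SUP T\<in>{T. e_statistic P' T}. expected_log (Q' g) T)"
        using translate[OF T] by (intro SUP_upper) simp
      finally show "expected_log Q T \<le> (SUP T\<in>{T. e_statistic P' T}. expected_log (Q' g) T)" .
    qed
  qed
  have S_finite: "\<bar>S\<bar> \<noteq> \<infinity>"
  proof -
    have "S \<le> ereal (1 + (\<integral>x. max 0 (ln (r x)) \<partial>Q) - ln (1 / 2))"
      unfolding S_def
    proof (intro SUP_least expected_log_le)
      fix T assume "T \<in> {T. e_statistic P' T}"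
      then have T: "T \<in> borel_measurable borel" "\<And>x. 0 \<le> T x" "\<And>g. (\<integral>\<^sup>+x. ennreal (T (act g x)) \<partial>P) \<le> 1"
        by (auto simp: e_stat)
      show "(\<integral>\<^sup>+x. ennreal (T x) \<partial>P) \<le> 1" using T(3)[of 0] by (simp add: act_0)
    qed (auto simp: e_stat)
    moreover have "ereal (\<integral>x. ln (ratio x) \<partial>Q) \<le> S"
      unfolding S_def expected_log_ratio[symmetric] using ratio by (intro SUP_upper) simp
    ultimately show ?thesis by auto
  qed
  have "relative_growth P' Q' T \<le> relative_growth P' Q' ratio" if "e_statistic P' T" for T
    using INF_minus_le[OF growth[OF that] S_finite]
    unfolding relative_growth_def S_eq by (simp add: E_ratio)
  then show "relatively_GROW P' Q' ratio"
    unfolding relatively_GROW_def using ratio by simp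
qed

end

theorem corollary5:
  fixes act :: "'g::{topological_group_add, polish_space} \<Rightarrow> 'x::polish_space \<Rightarrow> 'x"
    and P Q :: "'g \<Rightarrow> ('n::finite \<Rightarrow> 'x) measure"
    and p q :: "'g \<Rightarrow> ('n \<Rightarrow> 'x) \<Rightarrow> real"
    and \<mu> :: "('n \<Rightarrow> 'x) measure" and \<kappa> :: "'g \<Rightarrow> real"
    and m :: "('n \<Rightarrow> 'x) \<Rightarrow> 'm" and \<nu> :: "'m measure"
    and pM qM :: "'m \<Rightarrow> real" and \<epsilon> :: real
  assumes "amenable TYPE('g)"
    and "locally_compact_space (euclidean :: 'g topology)"
    and "locally_compact_space (euclidean :: ('n \<Rightarrow> 'x) topology)"
    and "is_action act"
    and "free_action (componentwise act)"
    and "continuous_action (componentwise act)" "proper_action (componentwise act)"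
    and "\<And>g. prob_space (P g) \<and> sets (P g) = sets borel"
    and "\<And>g. prob_space (Q g) \<and> sets (Q g) = sets borel"
    and "invariant_model (componentwise act) P" "invariant_model (componentwise act) Q"
    and "sets \<mu> = sets borel" "relatively_left_invariant (componentwise act) \<kappa> \<mu>"
    and "\<And>g. p g \<in> borel_measurable borel" "\<And>g x. 0 \<le> p g x"
    and "\<And>g. q g \<in> borel_measurable borel" "\<And>g x. 0 \<le> q g x"
    and "\<And>g. P g = density \<mu> (\<lambda>x. ennreal (p g x))"
    and "\<And>g. Q g = density \<mu> (\<lambda>x. ennreal (q g x))"
    and "single_common_support p q"
    and "m \<in> borel \<rightarrow>\<^sub>M \<nu>" "maximally_invariant (componentwise act) m"
    and "countably_separated (restrict_space \<nu> (range m))"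
    and "distributed (P 0) \<nu> m (\<lambda>y. ennreal (pM y))" "\<And>y. 0 \<le> pM y"
    and "distributed (Q 0) \<nu> m (\<lambda>y. ennreal (qM y))" "\<And>y. 0 \<le> qM y"
    and "0 < \<epsilon>"
    and "(\<integral>\<^sup>+x. ennreal (\<bar>ln (q 0 x / p 0 x)\<bar> powr (1 + \<epsilon>)) \<partial>Q 0) < \<infinity>"
    and "(\<integral>\<^sup>+y. ennreal (\<bar>ln (qM y / pM y)\<bar> powr (1 + \<epsilon>)) \<partial>distr (Q 0) \<nu> m) < \<infinity>"
  shows "GROW P Q (\<lambda>x. qM (m x) / pM (m x)) \<and>
         relatively_GROW P Q (\<lambda>x. qM (m x) / pM (m x))"
proof -
  note P_prob = assms(8) and Q_prob = assms(9)
    and P_density = assms(18) and Q_density = assms(19) and support = assms(20)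
  define A :: "'g \<Rightarrow> ('n \<Rightarrow> 'x) \<Rightarrow> 'n \<Rightarrow> 'x" where "A = componentwise act"
  define r where "r x = q 0 x / p 0 x" for x
  have action: "is_action A"
    using assms(4) unfolding A_def is_action_def componentwise_def by (intro conjI allI ext) blast+
  \<comment> \<open>The samples in the continuity hypothesis have an index type of their own, distinct from \<open>'n\<close>.\<close>
  have continuous: "continuous_action A"
    unfolding A_def by (rule continuous_action_componentwise_reindex[OF assms(6)])
  interpret P: prob_space "P 0" using P_prob[of 0] by (rule conjunct1)
  interpret Q: prob_space "Q 0" using Q_prob[of 0] by (rule conjunct1)
  have sets_P[measurable_cong]: "sets (P 0) = sets borel" and sets_Q[measurable_cong]: "sets (Q 0) = sets borel"
    using P_prob Q_prob by auto
  note [measurable] = assms(14,16,21)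
  have p_measurable: "p 0 \<in> borel_measurable \<mu>" "q 0 \<in> borel_measurable \<mu>"
    using assms(12,14,16) by (auto cong: measurable_cong_sets)
  have r: "Q 0 = density (P 0) (\<lambda>x. ennreal (r x))"
    unfolding P_density Q_density r_def
  proof (rule density_ratio[OF p_measurable assms(15,17)])
    show "0 < p 0 x" if "0 < q 0 x" for x
      using support that unfolding single_common_support_def by blast
  qed
  have r_measurable[measurable]: "r \<in> borel_measurable borel" unfolding r_def by measurable
  have Q_ac_P: "absolutely_continuous (P 0) (Q 0)"
    unfolding r by (rule absolutely_continuousI_density) measurable
  interpret lr: invariant_likelihood_ratio "P 0" "Q 0" m \<nu> pM qM
    by unfold_locales (fact sets_P sets_Q Q_ac_P assms)+
  have "integrable (Q 0) (\<lambda>x. ln (r x))"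
    using assms(29) by (intro Q.integrable_of_moment[OF _ assms(28)]) (simp_all add: r_def)
  moreover have "integrable (Q 0) (\<lambda>x. ln (qM (m x) / pM (m x)))"
    using assms(30) by (intro Q.integrable_of_moment[OF _ assms(28)]) (simp_all add: nn_integral_distr)
  moreover have "0 \<le> r x" for x using assms(15,17) by (simp add: r_def)
  ultimately interpret itp: invariant_testing_problem "P 0" "Q 0" m \<nu> pM qM A r
    using assms(1) action continuous assms(22) r r_measurable
    by unfold_locales (simp_all add: A_def)
  show ?thesis
    using itp.ratio_GROW_and_relatively_GROW[of P Q, OF
        invariant_model_eq_distr[OF action continuous P_prob assms(10)[folded A_def]]
        invariant_model_eq_distr[OF action continuous Q_prob assms(11)[folded A_def]]]
    by simp
qed

end
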